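(* For every positive integer $n$, all real numbers $q,r>0$, and all $w_1,w_2,\xi_1,\xi_2\in\mathbb{C}$ of modulus less than $1$, $$\frac{n!}{\pi^{n-1}}\,K_{D_{1/n}^{q,r}}\big((0,w_1,w_2),(0,\xi_1,\xi_2)\big)=K_{D_n^{q,r}}\big((0,\ldots,0,w_1,w_2),(0,\ldots,0,\xi_1,\xi_2)\big),$$ where on the right-hand side the first $n$ coordinates of both points are $0$.
   Context: For an integer $n\ge1$ and real $q,r>0$: $D_n^{q,r}=\{(z,w_1,w_2)\in\mathbb{C}^{n}\times\mathbb{C}\times\mathbb{C} : |z_1|^2+\cdots+|z_n|^2+|w_1|^q<1,\ |z_1|^2+\cdots+|z_n|^2+|w_2|^r<1\}$ and $D_{1/n}^{q,r}=\{(z,w_1,w_2)\in\mathbb{C}^3 : |z|^{2/n}+|w_1|^q<1,\ |z|^{2/n}+|w_2|^r<1\}$. For a bounded domain $D\subset\mathbb{C}^N$, $K_D$ denotes its Bergman kernel, $K_D(z,w)=\sum_j\Phi_j(z)\overline{\Phi_j(w)}$ for any complete orthonormal basis $\{\Phi_j\}$ of the space $L^2_a(D)$ of holomorphic functions on $D$ that are square integrable with respect to Lebesgue measure. *)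

theory Defs
  imports "HOL-Analysis.Analysis"
begin

text \<open>
  Holomorphy in several variables: real Frechet differentiability with a complex-linear derivative.
  (\<open>has_derivative\<close> already supplies additivity of \<open>f'\<close>.)
\<close>

definition holomorphic_several :: "(complex^'N \<Rightarrow> complex) \<Rightarrow> (complex^'N) set \<Rightarrow> bool"
  where "holomorphic_several f D \<longleftrightarrow>
    (\<forall>x\<in>D. \<exists>f'. (f has_derivative f') (at x within D) \<and> (\<forall>c v. f' (c *s v) = c * f' v))"

text \<open>
  Functions are total in HOL, so elements of this set are representatives: values outside \<open>D\<close>
  are arbitrary and never enter the integrals below.  On \<open>complex^'N\<close>, which is a Euclidean space
  of real dimension twice \<open>CARD('N)\<close>, \<open>lborel\<close> is Lebesgue measure.
\<close>

definition bergman_space :: "(complex^'N) set \<Rightarrow> (complex^'N \<Rightarrow> complex) set"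
  where "bergman_space D =
    {f. holomorphic_several f D \<and> set_integrable lborel D (\<lambda>x. (cmod (f x))\<^sup>2)}"

definition L2_inner :: "(complex^'N) set \<Rightarrow> (complex^'N \<Rightarrow> complex) \<Rightarrow> (complex^'N \<Rightarrow> complex) \<Rightarrow> complex"
  where "L2_inner D f g = (LINT x:D|lborel. f x * cnj (g x))"

text \<open>
  Completeness of an orthonormal system means that its finite linear combinations are dense in
  the Bergman space with respect to the \<open>L\<^sup>2\<close> norm.
\<close>

definition complete_orthonormal_basis :: "(complex^'N) set \<Rightarrow> (complex^'N \<Rightarrow> complex) set \<Rightarrow> bool"
  where "complete_orthonormal_basis D B \<longleftrightarrow>
    B \<subseteq> bergman_space D \<and>
    (\<forall>\<phi>\<in>B. \<forall>\<psi>\<in>B. L2_inner D \<phi> \<psi> = (if \<phi> = \<psi> then 1 else 0)) \<and>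
    (\<forall>f\<in>bergman_space D. \<forall>\<epsilon>>0. \<exists>F c. finite F \<and> F \<subseteq> B \<and>
        (LINT x:D|lborel. (cmod (f x - (\<Sum>\<phi>\<in>F. c \<phi> * \<phi> x)))\<^sup>2) < \<epsilon>)"

text \<open>
  The kernel is the value that the series takes for every complete orthonormal basis; the
  definite description makes the independence of the basis part of the definition.
\<close>

definition bergman_kernel :: "(complex^'N) set \<Rightarrow> complex^'N \<Rightarrow> complex^'N \<Rightarrow> complex"
  where "bergman_kernel D z w =
    (THE k. \<forall>B. complete_orthonormal_basis D B \<longrightarrow> ((\<lambda>\<phi>. \<phi> z * cnj (\<phi> w)) has_sum k) B)"

text \<open>
  The point \<open>(z, w\<^sub>1, w\<^sub>2)\<close> of the product of \<open>n\<close>-dimensional complex space with two further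
  complex lines, where \<open>n = CARD('n)\<close>; the index type \<open>'n + 2\<close> has \<open>n + 2\<close> elements.
\<close>

definition join_point :: "complex^'n \<Rightarrow> complex \<Rightarrow> complex \<Rightarrow> complex^('n + 2)"
  where "join_point z w1 w2 = (\<chi> k. case k of Inl i \<Rightarrow> z $ i | Inr j \<Rightarrow> vector [w1, w2] $ j)"

text \<open>
  In both domains \<open>powr\<close> is applied to nonnegative reals with positive exponents, where the
  convention \<open>0 powr a = 0\<close> is the right one.
\<close>

definition D_dom :: "real \<Rightarrow> real \<Rightarrow> (complex^('n::finite + 2)) set"
  where "D_dom q r = {join_point z w1 w2 | z w1 w2.
    (\<Sum>i\<in>UNIV. (cmod (z $ i))\<^sup>2) + cmod w1 powr q < 1 \<and>
    (\<Sum>i\<in>UNIV. (cmod (z $ i))\<^sup>2) + cmod w2 powr r < 1}"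

definition D_inv_dom :: "nat \<Rightarrow> real \<Rightarrow> real \<Rightarrow> (complex^3) set"
  where "D_inv_dom n q r = {vector [z, w1, w2] | z w1 w2.
    cmod z powr (2 / real n) + cmod w1 powr q < 1 \<and>
    cmod z powr (2 / real n) + cmod w2 powr r < 1}"

end

theory Submission
  imports Defs "HOL-Library.Function_Algebras" "HOL-Complex_Analysis.Cauchy_Integral_Formula"
begin

text \<open>
  Both domains are fibred over the unit bidisc of the variables \<open>(w\<^sub>1, w\<^sub>2)\<close>.  With
  \<open>\<rho> = min (1 - \<bar>w\<^sub>1\<bar>\<^sup>q) (1 - \<bar>w\<^sub>2\<bar>\<^sup>r)\<close>, the fibre of the first domain is a ball in complex
  \<open>n\<close>-space of volume \<open>\<pi>\<^sup>n \<rho>\<^sup>n / n!\<close>, and that of the second is a disc of area \<open>\<pi> \<rho>\<^sup>n\<close>.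
  The quotient \<open>\<pi>\<^sup>n\<^sup>-\<^sup>1 / n!\<close> is the same for all \<open>w\<close>.

  Replacing the fibre coordinates by \<open>0\<close> sends a holomorphic function \<open>f\<close> to a function that is
  constant along the fibres and has the same values on the central slice.  By the mean value property
  this is a contraction of the Bergman space, hence the orthogonal projection onto the functions of
  \<open>w\<close> alone (\<open>circular_retraction_nn_integral_le\<close>, \<open>circular_retraction_orthogonal\<close>).  So the kernel
  functions for points of the central slice depend on \<open>w\<close> only.  On functions of \<open>w\<close> the two inner
  products are integrals over the bidisc and differ by the constant quotient of the fibre volumes
  (\<open>integral_base\<close>).  Therefore a kernel function of one domain, divided by this quotient, is a kernel
  function of the other (\<open>reproduces_D_dom\<close>).

  To read this as a statement on the series over orthonormal bases that defines the kernel, one needs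
  that every bounded evaluation has a reproducing function, that a complete orthonormal basis exists,
  and that Parseval's identity holds.  These are proved for complete semi-inner-product spaces.
  The Bergman space is one: evaluations are locally uniformly bounded by the mean value property on
  balls, so Cauchy sequences converge locally uniformly together with their derivatives
  (\<open>holomorphic_limit\<close>, \<open>bergman_space_complete\<close>).  The conclusion is \<open>bergman_kernel_eqI\<close>: the kernel
  is the value of any reproducing function.
\<close>

section \<open>Complete semi-inner-product spaces\<close>

lemma tendsto_zero_if_norm_square_le:
  fixes z :: "nat \<Rightarrow> complex"
  assumes le: "\<And>n. (cmod (z n))\<^sup>2 \<le> b n" and b: "b \<longlonglongrightarrow> 0"
  shows "z \<longlonglongrightarrow> 0"
proof -
  have "(\<lambda>n. (cmod (z n))\<^sup>2) \<longlonglongrightarrow> 0"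
    by (rule tendsto_sandwich[OF _ _ tendsto_const b]) (simp_all add: le)
  from tendsto_real_sqrt[OF this] show ?thesis by (simp add: tendsto_norm_zero_iff)
qed

text \<open>
  A Bergman space consists of functions on the whole space whose values outside the domain do not
  enter the inner product, so this inner product is only positive semidefinite.  Completeness is
  therefore required up to vectors of square norm \<open>0\<close>, and nothing is factored out.
\<close>

locale semi_hilbert = vector_space scale
  for scale :: "complex \<Rightarrow> 'v::ab_group_add \<Rightarrow> 'v" (infixr \<open>\<odot>\<close> 75) +
  fixes H :: "'v set" and ip :: "'v \<Rightarrow> 'v \<Rightarrow> complex"
  assumes subspace_H: "subspace H"
    and ip_add_left: "\<lbrakk>f \<in> H; g \<in> H; h \<in> H\<rbrakk> \<Longrightarrow> ip (f + g) h = ip f h + ip g h"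
    and ip_scale_left: "\<lbrakk>f \<in> H; h \<in> H\<rbrakk> \<Longrightarrow> ip (c \<odot> f) h = c * ip f h"
    and ip_cnj: "\<lbrakk>f \<in> H; g \<in> H\<rbrakk> \<Longrightarrow> ip g f = cnj (ip f g)"
    and ip_nonneg: "f \<in> H \<Longrightarrow> 0 \<le> Re (ip f f)"
    and cauchy_limit: "\<lbrakk>\<And>n::nat. F n \<in> H;
          \<And>e. e > 0 \<Longrightarrow> \<exists>N. \<forall>m\<ge>N. \<forall>n\<ge>N. Re (ip (F m - F n) (F m - F n)) < e\<rbrakk> \<Longrightarrow>
          \<exists>g\<in>H. (\<lambda>n. Re (ip (F n - g) (F n - g))) \<longlonglongrightarrow> 0"
begin

definition sqn :: "'v \<Rightarrow> real" where "sqn f = Re (ip f f)"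

lemma H_closed [simp, intro]:
  "0 \<in> H" "\<lbrakk>f \<in> H; g \<in> H\<rbrakk> \<Longrightarrow> f + g \<in> H" "\<lbrakk>f \<in> H; g \<in> H\<rbrakk> \<Longrightarrow> f - g \<in> H"
  "f \<in> H \<Longrightarrow> c \<odot> f \<in> H"
  using subspace_H by (auto intro: subspace_0 subspace_add subspace_diff subspace_scale)

lemma H_sum [simp, intro]: "(\<And>i. i \<in> I \<Longrightarrow> f i \<in> H) \<Longrightarrow> (\<Sum>i\<in>I. f i) \<in> H"
  using subspace_H by (rule subspace_sum)

lemma ip_diff_left: "\<lbrakk>f \<in> H; g \<in> H; h \<in> H\<rbrakk> \<Longrightarrow> ip (f - g) h = ip f h - ip g h"
  using ip_add_left[of "f - g" g h] by simp

lemma ip_add_right: "\<lbrakk>f \<in> H; g \<in> H; h \<in> H\<rbrakk> \<Longrightarrow> ip h (f + g) = ip h f + ip h g"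
  by (metis H_closed(2) complex_cnj_add ip_add_left ip_cnj)

lemma ip_diff_right: "\<lbrakk>f \<in> H; g \<in> H; h \<in> H\<rbrakk> \<Longrightarrow> ip h (f - g) = ip h f - ip h g"
  by (metis H_closed(3) complex_cnj_diff ip_diff_left ip_cnj)

lemma ip_scale_right: "\<lbrakk>f \<in> H; h \<in> H\<rbrakk> \<Longrightarrow> ip h (c \<odot> f) = cnj c * ip h f"
  by (metis H_closed(4) complex_cnj_mult ip_scale_left ip_cnj)

lemma ip_zero_left [simp]: "h \<in> H \<Longrightarrow> ip 0 h = 0"
  using ip_diff_left[of h h h] by simp

lemma ip_sum_left:
  "\<lbrakk>\<And>i. i \<in> I \<Longrightarrow> f i \<in> H; h \<in> H\<rbrakk> \<Longrightarrow> ip (\<Sum>i\<in>I. f i) h = (\<Sum>i\<in>I. ip (f i) h)"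
  by (induction I rule: infinite_finite_induct) (simp_all add: ip_add_left)

lemma ip_self: "f \<in> H \<Longrightarrow> ip f f = of_real (sqn f)"
  using ip_cnj[of f f] by (simp add: sqn_def complex_eq_iff)

lemma sqn_nonneg: "f \<in> H \<Longrightarrow> 0 \<le> sqn f"
  by (simp add: sqn_def ip_nonneg)

lemma sqn_add: "\<lbrakk>f \<in> H; g \<in> H\<rbrakk> \<Longrightarrow> sqn (f + g) = sqn f + 2 * Re (ip f g) + sqn g"
  using ip_cnj[of f g] by (simp add: sqn_def ip_add_left ip_add_right)

lemma sqn_diff: "\<lbrakk>f \<in> H; g \<in> H\<rbrakk> \<Longrightarrow> sqn (f - g) = sqn f - 2 * Re (ip f g) + sqn g"
  using ip_cnj[of f g] by (simp add: sqn_def ip_diff_left ip_diff_right)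

lemma sqn_scale:
  assumes f: "f \<in> H"
  shows "sqn (c \<odot> f) = (cmod c)\<^sup>2 * sqn f"
proof -
  have "ip (c \<odot> f) (c \<odot> f) = (c * cnj c) * ip f f"
    using f by (simp add: ip_scale_left ip_scale_right)
  also have "\<dots> = of_real ((cmod c)\<^sup>2 * sqn f)"
    using f by (simp only: ip_self of_real_mult complex_norm_square)
  finally show ?thesis by (simp only: sqn_def[of "c \<odot> f"] Re_complex_of_real)
qed

lemma sqn_minus_commute: "\<lbrakk>f \<in> H; g \<in> H\<rbrakk> \<Longrightarrow> sqn (f - g) = sqn (g - f)"
  using ip_cnj[of f g] by (simp add: sqn_diff)

text \<open>
  The variational inequality behind both Cauchy--Schwarz and orthogonal projection: if moving
  \<open>u\<close> along \<open>v\<close> lowers the square norm by at most \<open>e\<close>, then \<open>u\<close> is almost orthogonal to \<open>v\<close>.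
\<close>

lemma almost_minimal_imp_almost_orthogonal:
  assumes u: "u \<in> H" and v: "v \<in> H" and e: "\<And>t. sqn u - e \<le> sqn (u - t \<odot> v)"
  shows "(cmod (ip u v))\<^sup>2 \<le> e * sqn v"
proof -
  define b where "b = (cmod (ip u v))\<^sup>2"
  have *: "2 * s * b - s\<^sup>2 * b * sqn v \<le> e" for s :: real
  proof -
    have "sqn (u - (of_real s * ip u v) \<odot> v) = sqn u - 2 * s * b + s\<^sup>2 * b * sqn v"
      using u v
      by (simp add: sqn_diff ip_scale_right sqn_scale norm_mult power_mult_distrib b_def
          complex_mult_cnj cmod_power2 algebra_simps flip: power2_eq_square)
    then show ?thesis using e[of "of_real s * ip u v"] by simp
  qed
  have b0: "b \<ge> 0" by (simp add: b_def)
  show ?thesis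
  proof (cases "sqn v = 0")
    case True
    have "b = 0"
    proof (rule ccontr)
      assume "b \<noteq> 0"
      moreover have "e + 1 \<le> e" if "b \<noteq> 0" using *[of "(e + 1) / (2 * b)"] True that by simp
      ultimately show False by simp
    qed
    then show ?thesis using True by (simp add: b_def)
  next
    case False
    then have "sqn v > 0" using sqn_nonneg[OF v] by simp
    with *[of "1 / sqn v"] have "b / sqn v \<le> e"
      by (simp add: power2_eq_square field_simps)
    then show ?thesis using \<open>sqn v > 0\<close> by (simp add: b_def field_simps)
  qed
qed

lemma Cauchy_Schwarz: "\<lbrakk>f \<in> H; g \<in> H\<rbrakk> \<Longrightarrow> (cmod (ip f g))\<^sup>2 \<le> sqn f * sqn g"
  by (rule almost_minimal_imp_almost_orthogonal) (auto simp: sqn_nonneg)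

lemma parallelogram: "\<lbrakk>f \<in> H; g \<in> H\<rbrakk> \<Longrightarrow> sqn (f + g) + sqn (f - g) = 2 * sqn f + 2 * sqn g"
  by (simp add: sqn_add sqn_diff)

lemma sqn_add_le: "\<lbrakk>f \<in> H; g \<in> H\<rbrakk> \<Longrightarrow> sqn (f + g) \<le> 2 * sqn f + 2 * sqn g"
  using parallelogram[of f g] sqn_nonneg[of "f - g"] by simp

text \<open>
  A minimizing sequence for the distance from \<open>f\<close> to \<open>V\<close> is Cauchy by the parallelogram law.  Its
  members are almost minimal, hence \<open>f\<close> minus each of them is almost orthogonal to \<open>V\<close>, and
  orthogonality holds exactly in the limit.
\<close>

proposition orthogonal_projection:
  assumes V: "subspace V" "V \<subseteq> H" and f: "f \<in> H"
  obtains g where "g \<in> H" "\<And>e. e > 0 \<Longrightarrow> \<exists>v\<in>V. sqn (v - g) < e" "\<And>v. v \<in> V \<Longrightarrow> ip (f - g) v = 0"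
proof -
  define \<delta> where "\<delta> = Inf ((\<lambda>v. sqn (f - v)) ` V)"
  have bdd: "bdd_below ((\<lambda>v. sqn (f - v)) ` V)"
    using V f by (intro bdd_belowI[where m=0]) (auto intro!: sqn_nonneg)
  have \<delta>_le: "\<delta> \<le> sqn (f - v)" if "v \<in> V" for v
    unfolding \<delta>_def using bdd that by (auto intro: cInf_lower)
  have ne: "(\<lambda>v. sqn (f - v)) ` V \<noteq> {}" using subspace_0[OF V(1)] by auto
  have "\<exists>v\<in>V. sqn (f - v) < \<delta> + inverse (real (Suc n))" for n
    using cInf_lessD[OF ne, of "\<delta> + inverse (real (Suc n))"] by (auto simp: \<delta>_def)
  then obtain w where w: "\<And>n. w n \<in> V" "\<And>n. sqn (f - w n) < \<delta> + inverse (real (Suc n))" by metis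
  have wH: "w n \<in> H" for n using w(1) V by auto
  have cau: "\<exists>N. \<forall>m\<ge>N. \<forall>n\<ge>N. sqn (w m - w n) < e" if e: "e > 0" for e
  proof -
    obtain N where N: "inverse (real (Suc N)) < e / 4"
      using reals_Archimedean[of "e/4"] e by auto
    have "sqn (w m - w n) < e" if mn: "m \<ge> N" "n \<ge> N" for m n
    proof -
      let ?mid = "(1/2) \<odot> (w m + w n)"
      have "(f - w m) + (f - w n) = 2 \<odot> (f - ?mid)"
        using scale_left_distrib[of 1 1 f]
        by (simp add: scale_right_diff_distrib algebra_simps)
      moreover have "(f - w n) - (f - w m) = w m - w n" by simp
      ultimately have "4 * sqn (f - ?mid) + sqn (w m - w n) = 2 * sqn (f - w m) + 2 * sqn (f - w n)"
        using parallelogram[of "f - w n" "f - w m"] f wH by (simp add: add.commute sqn_scale)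
      moreover have "\<delta> \<le> sqn (f - ?mid)"
        by (intro \<delta>_le) (use V w in \<open>auto intro!: subspace_scale subspace_add\<close>)
      moreover have "inverse (real (Suc m)) \<le> inverse (real (Suc N))"
        "inverse (real (Suc n)) \<le> inverse (real (Suc N))"
        using mn by simp_all
      ultimately show ?thesis using w(2)[of m] w(2)[of n] N by linarith
    qed
    then show ?thesis by blast
  qed
  obtain g where g: "g \<in> H" "(\<lambda>n. sqn (w n - g)) \<longlonglongrightarrow> 0"
    using cauchy_limit[of w] wH cau unfolding sqn_def by blast
  show ?thesis
  proof (rule that[OF g(1)])
    show "\<exists>v\<in>V. sqn (v - g) < e" if "e > 0" for e
    proof -
      have "\<forall>\<^sub>F n in sequentially. sqn (w n - g) < e"
        using g(2) that by (rule order_tendstoD)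
      then show ?thesis using w(1) by (auto simp: eventually_sequentially)
    qed
    show "ip (f - g) v = 0" if v: "v \<in> V" for v
    proof -
      have vH: "v \<in> H" using v V by auto
      have le: "(cmod (ip (f - w n) v))\<^sup>2 \<le> inverse (real (Suc n)) * sqn v" for n
      proof (rule almost_minimal_imp_almost_orthogonal)
        fix t
        have "\<delta> \<le> sqn (f - (w n + t \<odot> v))"
          by (intro \<delta>_le) (use V w v in \<open>auto intro!: subspace_scale subspace_add\<close>)
        moreover have "f - (w n + t \<odot> v) = f - w n - t \<odot> v" by simp
        ultimately show "sqn (f - w n) - inverse (real (Suc n)) \<le> sqn (f - w n - t \<odot> v)"
          using w(2)[of n] by simp
      qed (use f wH vH in auto)
      have 1: "(\<lambda>n. ip (f - w n) v) \<longlonglongrightarrow> 0"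
        using le tendsto_mult_left_zero[OF LIMSEQ_inverse_real_of_nat]
        by (rule tendsto_zero_if_norm_square_le)
      have le': "(cmod (ip (w n - g) v))\<^sup>2 \<le> sqn (w n - g) * sqn v" for n
        using wH g vH by (intro Cauchy_Schwarz) auto
      have 2: "(\<lambda>n. ip (w n - g) v) \<longlonglongrightarrow> 0"
        using le' tendsto_mult_left_zero[OF g(2)] by (rule tendsto_zero_if_norm_square_le)
      have "(\<lambda>n. ip (f - w n) v + ip (w n - g) v) \<longlonglongrightarrow> 0"
        using tendsto_add[OF 1 2] by simp
      moreover have "ip (f - w n) v + ip (w n - g) v = ip (f - g) v" for n
        using f wH g vH by (simp add: ip_diff_left)
      ultimately show ?thesis by (simp add: LIMSEQ_const_iff)
    qed
  qed
qed

text \<open>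
  The component \<open>u\<close> of some \<open>f\<close> with \<open>L f \<noteq> 0\<close> orthogonal to the kernel of \<open>L\<close> spans the
  complement of that kernel, so a multiple of \<open>u\<close> represents \<open>L\<close>.  Boundedness of \<open>L\<close> keeps the
  projection of \<open>f\<close>, a limit of zeros of \<open>L\<close>, inside the kernel.
\<close>

proposition Riesz_representation:
  assumes add: "\<And>f g. \<lbrakk>f \<in> H; g \<in> H\<rbrakk> \<Longrightarrow> L (f + g) = L f + L g"
    and scale: "\<And>f c. f \<in> H \<Longrightarrow> L (c \<odot> f) = c * L f"
    and bound: "\<And>f. f \<in> H \<Longrightarrow> (cmod (L f))\<^sup>2 \<le> C * sqn f"
  obtains k where "k \<in> H" "\<And>f. f \<in> H \<Longrightarrow> ip f k = L f"
proof (cases "\<forall>f\<in>H. L f = 0")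
  case True
  then show ?thesis using that[of 0] ip_cnj[of 0] by simp
next
  case False
  then obtain f where f: "f \<in> H" "L f \<noteq> 0" by auto
  have diff: "L (f - g) = L f - L g" if "f \<in> H" "g \<in> H" for f g
    using add[of "f - g" g] that by simp
  let ?V = "{h\<in>H. L h = 0}"
  have "subspace ?V"
    using scale[of 0 0] by (auto simp: subspace_def add scale)
  then obtain g where g: "g \<in> H" "\<And>e. e > 0 \<Longrightarrow> \<exists>v\<in>?V. sqn (v - g) < e"
      "\<And>v. v \<in> ?V \<Longrightarrow> ip (f - g) v = 0"
    using orthogonal_projection[of ?V f] f by blast
  have C: "C > 0"
    using bound[OF f(1)] f(2) sqn_nonneg[OF f(1)]
    by (metis mult_nonpos_nonneg not_le order.trans zero_less_norm_iff zero_less_power)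
  have "L g = 0"
  proof (rule ccontr)
    assume "L g \<noteq> 0"
    then have "(cmod (L g))\<^sup>2 / C > 0" using C by simp
    then obtain v where v: "v \<in> H" "L v = 0" "sqn (v - g) < (cmod (L g))\<^sup>2 / C"
      using g(2) by blast
    then show False
      using bound[of "v - g"] diff[of v g] g(1) C by (simp add: field_simps)
  qed
  define u where "u = f - g"
  have u: "u \<in> H" "L u \<noteq> 0" using f g \<open>L g = 0\<close> by (auto simp: u_def diff)
  have su: "sqn u \<noteq> 0" using bound[OF u(1)] u(2) by auto
  show ?thesis
  proof (rule that[of "(cnj (L u) / of_real (sqn u)) \<odot> u"])
    fix h assume h: "h \<in> H"
    let ?v = "h - (L h / L u) \<odot> u"
    have "ip u ?v = 0" unfolding u_def
      by (intro g(3)) (use h u in \<open>auto simp: diff scale u_def\<close>)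
    then have "ip ?v u = 0" using ip_cnj[of u ?v] h u by simp
    then have "ip h u = L h / L u * sqn u"
      using h u by (simp add: ip_diff_left ip_scale_left ip_self)
    then show "ip h ((cnj (L u) / of_real (sqn u)) \<odot> u) = L h"
      using h u su by (simp add: ip_scale_right)
  qed (use u in auto)
qed

definition orthonormal :: "'v set \<Rightarrow> bool"
  where "orthonormal B \<longleftrightarrow> B \<subseteq> H \<and> (\<forall>\<phi>\<in>B. \<forall>\<psi>\<in>B. ip \<phi> \<psi> = (if \<phi> = \<psi> then 1 else 0))"

text \<open>
  By Zorn's lemma there is a maximal orthonormal set.  If its span were not dense, the normalized
  difference between some vector and its projection to the closure of the span would extend it.
\<close>

proposition exists_orthonormal_basis:
  obtains B where "orthonormal B"
    "\<And>f e. \<lbrakk>f \<in> H; e > 0\<rbrakk> \<Longrightarrow> \<exists>F c. finite F \<and> F \<subseteq> B \<and> sqn (f - (\<Sum>\<phi>\<in>F. c \<phi> \<odot> \<phi>)) < e"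
proof -
  have "\<exists>B. orthonormal B \<and> (\<forall>B'. orthonormal B' \<and> B \<subseteq> B' \<longrightarrow> B' = B)"
  proof -
    have "\<exists>M\<in>Collect orthonormal. \<forall>X\<in>Collect orthonormal. M \<subseteq> X \<longrightarrow> X = M"
    proof (rule subset_Zorn')
      fix \<C> assume C: "subset.chain (Collect orthonormal) \<C>"
      then have "\<forall>X\<in>\<C>. orthonormal X" "\<And>X Y. \<lbrakk>X \<in> \<C>; Y \<in> \<C>\<rbrakk> \<Longrightarrow> X \<subseteq> Y \<or> Y \<subseteq> X"
        by (auto simp: subset.chain_def)
      then show "\<Union>\<C> \<in> Collect orthonormal"
        unfolding orthonormal_def mem_Collect_eq by (smt (verit) UnionE Union_least subsetD)
    qed
    then show ?thesis by auto
  qed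
  then obtain B where B: "orthonormal B" and max: "\<And>B'. \<lbrakk>orthonormal B'; B \<subseteq> B'\<rbrakk> \<Longrightarrow> B' = B"
    by metis
  have BH: "B \<subseteq> H" using B by (simp add: orthonormal_def)
  show ?thesis
  proof (rule that[OF B])
    fix f and e :: real assume f: "f \<in> H" and e: "e > 0"
    have sp: "span B \<subseteq> H" using BH subspace_H by (rule span_minimal)
    obtain g where g: "g \<in> H" "\<And>e. e > 0 \<Longrightarrow> \<exists>v\<in>span B. sqn (v - g) < e"
        "\<And>v. v \<in> span B \<Longrightarrow> ip (f - g) v = 0"
      using orthogonal_projection[OF subspace_span sp f] by metis
    define u where "u = f - g"
    have u: "u \<in> H" using f g by (simp add: u_def)
    have "sqn u = 0"
    proof (rule ccontr)
      assume "sqn u \<noteq> 0"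
      then have s: "sqn u > 0" using sqn_nonneg[OF u] by simp
      define \<psi> where "\<psi> = of_real (1 / sqrt (sqn u)) \<odot> u"
      have \<psi>: "\<psi> \<in> H" "ip \<psi> \<psi> = 1"
        using u s by (auto simp: \<psi>_def ip_scale_left ip_scale_right ip_self[OF u] simp flip: of_real_mult)
      have orth: "ip \<psi> \<phi> = 0" if "\<phi> \<in> B" for \<phi>
        using g(3)[OF span_base[OF that]] u that BH by (auto simp: \<psi>_def ip_scale_left u_def)
      then have orth': "ip \<phi> \<psi> = 0" if "\<phi> \<in> B" for \<phi>
        using ip_cnj[of \<psi> \<phi>] that \<psi> BH by auto
      have "\<psi> \<notin> B" using orth[of \<psi>] \<psi> by auto
      have "orthonormal (insert \<psi> B)"
        using B \<psi> orth orth' \<open>\<psi> \<notin> B\<close> by (auto simp: orthonormal_def)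
      then show False using max[of "insert \<psi> B"] \<open>\<psi> \<notin> B\<close> by auto
    qed
    obtain v where v: "v \<in> span B" "sqn (v - g) < e / 2" using g(2)[of "e/2"] e by auto
    have vH: "v \<in> H" using v(1) sp by auto
    have eq: "f - v = u + (g - v)" by (simp add: u_def)
    have "sqn (f - v) \<le> 2 * sqn u + 2 * sqn (v - g)"
      unfolding eq sqn_minus_commute[OF vH g(1)] using u g(1) vH by (intro sqn_add_le) auto
    then have "sqn (f - v) < e" using \<open>sqn u = 0\<close> v(2) by simp
    with v(1) show "\<exists>F c. finite F \<and> F \<subseteq> B \<and> sqn (f - (\<Sum>\<phi>\<in>F. c \<phi> \<odot> \<phi>)) < e"
      unfolding span_explicit by auto
  qed
qed

text \<open>
  The net of finite partial sums converges because the Fourier sum over a finite set \<open>F\<close> is at least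
  as close to \<open>f\<close> as any linear combination over a subset of \<open>F\<close>; Cauchy--Schwarz against \<open>g\<close>
  then bounds the error.
\<close>

proposition Parseval:
  assumes B: "orthonormal B"
    and dense: "\<And>f e. \<lbrakk>f \<in> H; e > 0\<rbrakk> \<Longrightarrow>
       \<exists>F c. finite F \<and> F \<subseteq> B \<and> sqn (f - (\<Sum>\<phi>\<in>F. c \<phi> \<odot> \<phi>)) < e"
    and f: "f \<in> H" and g: "g \<in> H"
  shows "((\<lambda>\<phi>. ip f \<phi> * ip \<phi> g) has_sum ip f g) B"
proof -
  have BH: "\<phi> \<in> H" if "\<phi> \<in> B" for \<phi> using B that by (auto simp: orthonormal_def)
  define P where "P F = (\<Sum>\<phi>\<in>F. ip f \<phi> \<odot> \<phi>)" for F
  have PH: "P F \<in> H" if "F \<subseteq> B" for F using that BH f by (auto simp: P_def)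
  have orth: "ip (f - P F) \<psi> = 0" if F: "finite F" "F \<subseteq> B" "\<psi> \<in> F" for F \<psi>
  proof -
    have "ip (P F) \<psi> = (\<Sum>\<phi>\<in>F. ip f \<phi> * ip \<phi> \<psi>)"
      unfolding P_def using F BH f by (subst ip_sum_left) (auto simp: ip_scale_left subset_iff)
    also have "\<dots> = (\<Sum>\<phi>\<in>F. if \<phi> = \<psi> then ip f \<psi> else 0)"
      by (intro sum.cong) (use B F in \<open>auto simp: orthonormal_def subset_iff\<close>)
    finally show ?thesis using F f BH PH[OF F(2)] by (auto simp: ip_diff_left)
  qed
  \<comment> \<open>Partial Fourier sums are the best approximations, also from any smaller set of basis vectors.\<close>
  have best: "sqn (f - P F) \<le> sqn (f - (\<Sum>\<phi>\<in>G. c \<phi> \<odot> \<phi>))"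
    if F: "finite F" "G \<subseteq> F" "F \<subseteq> B" for F G c
  proof -
    have GH: "\<phi> \<in> H" if "\<phi> \<in> G" for \<phi> using that F BH by auto
    define h where "h = P F - (\<Sum>\<phi>\<in>G. c \<phi> \<odot> \<phi>)"
    have h: "h \<in> H" using PH F GH by (auto simp: h_def)
    have uH: "f - P F \<in> H" using f PH F by auto
    have z: "ip (\<Sum>\<phi>\<in>I. a \<phi> \<odot> \<phi>) (f - P F) = 0" if "I \<subseteq> F" for I a
    proof -
      have "ip (\<Sum>\<phi>\<in>I. a \<phi> \<odot> \<phi>) (f - P F) = (\<Sum>\<phi>\<in>I. a \<phi> * ip \<phi> (f - P F))"
        using that F BH f uH by (subst ip_sum_left) (auto simp: ip_scale_left subset_iff)
      also have "\<dots> = 0"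
      proof (intro sum.neutral ballI)
        fix \<phi> assume "\<phi> \<in> I"
        then have "\<phi> \<in> F" "\<phi> \<in> H" using that F BH by auto
        then show "a \<phi> * ip \<phi> (f - P F) = 0"
          using ip_cnj[OF uH, of \<phi>] orth[of F \<phi>] F by simp
      qed
      finally show ?thesis .
    qed
    have "ip (P F) (f - P F) = 0" using z[of F "ip f"] by (simp only: P_def order_refl)
    moreover have "ip (\<Sum>\<phi>\<in>G. c \<phi> \<odot> \<phi>) (f - P F) = 0" by (rule z[OF F(2)])
    moreover have "(\<Sum>\<phi>\<in>G. c \<phi> \<odot> \<phi>) \<in> H" using GH by auto
    ultimately have "ip h (f - P F) = 0"
      unfolding h_def using PH[OF F(3)] uH by (simp only: ip_diff_left diff_self)
    then have "ip (f - P F) h = 0" using ip_cnj[OF h uH] by simp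
    then have "sqn (f - P F) \<le> sqn (f - P F + h)"
      using sqn_add[OF uH h] sqn_nonneg[OF h] by simp
    moreover have "f - P F + h = f - (\<Sum>\<phi>\<in>G. c \<phi> \<odot> \<phi>)" by (simp add: h_def)
    ultimately show ?thesis by (simp only:)
  qed
  show ?thesis unfolding has_sum_def tendsto_iff eventually_finite_subsets_at_top
  proof (intro allI impI)
    fix e :: real assume e: "e > 0"
    have e': "e\<^sup>2 / (sqn g + 1) > 0" using e sqn_nonneg[OF g] by (auto intro!: divide_pos_pos)
    obtain G c where G: "finite G" "G \<subseteq> B" "sqn (f - (\<Sum>\<phi>\<in>G. c \<phi> \<odot> \<phi>)) < e\<^sup>2 / (sqn g + 1)"
      using dense[OF f e'] by auto
    have "dist (\<Sum>\<phi>\<in>F. ip f \<phi> * ip \<phi> g) (ip f g) < e" if F: "finite F" "G \<subseteq> F" "F \<subseteq> B" for F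
    proof -
      have "(\<Sum>\<phi>\<in>F. ip f \<phi> * ip \<phi> g) = ip (P F) g"
        unfolding P_def using F BH g by (subst ip_sum_left) (auto simp: ip_scale_left subset_iff)
      then have "dist (\<Sum>\<phi>\<in>F. ip f \<phi> * ip \<phi> g) (ip f g) = cmod (ip (f - P F) g)"
        using f g PH[OF F(3)] by (simp add: dist_norm ip_diff_left norm_minus_commute)
      moreover have "(cmod (ip (f - P F) g))\<^sup>2 < e\<^sup>2"
      proof -
        have "(cmod (ip (f - P F) g))\<^sup>2 \<le> sqn (f - P F) * sqn g"
          using f g PH[OF F(3)] by (intro Cauchy_Schwarz) auto
        also have "\<dots> \<le> sqn (f - P F) * (sqn g + 1)"
          using f PH[OF F(3)] by (intro mult_left_mono) (auto intro: sqn_nonneg)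
        also have "\<dots> < e\<^sup>2"
        proof -
          have "sqn (f - P F) < e\<^sup>2 / (sqn g + 1)"
            using best[OF F, of c] G(3) by (rule order.strict_trans1)
          moreover have "sqn g + 1 > 0" using sqn_nonneg[OF g] by simp
          ultimately show ?thesis by (simp only: pos_less_divide_eq)
        qed
        finally show ?thesis .
      qed
      ultimately show ?thesis using e by (simp add: power_less_imp_less_base)
    qed
    then show "\<exists>X. finite X \<and> X \<subseteq> B \<and>
        (\<forall>Y. finite Y \<and> X \<subseteq> Y \<and> Y \<subseteq> B \<longrightarrow> dist (\<Sum>\<phi>\<in>Y. ip f \<phi> * ip \<phi> g) (ip f g) < e)"
      using G by blast
  qed
qed

end

section \<open>Isometries preserve Lebesgue measure\<close>

lemma negligible_isometry_preimage:
  fixes f :: "'a::euclidean_space \<Rightarrow> 'b::euclidean_space"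
  assumes iso: "\<And>x y. dist (f x) (f y) = dist x y" and dim: "DIM('b) \<le> DIM('a)"
    and S: "negligible S"
  shows "negligible (f -` S)"
proof -
  have inj: "inj f" by (rule injI) (metis iso dist_eq_0_iff)
  let ?g = "inv f"
  have "negligible (?g ` (S \<inter> range f))"
  proof (rule negligible_locally_Lipschitz_image[OF dim])
    fix y assume y: "y \<in> S \<inter> range f"
    have "norm (?g z - ?g y) \<le> 1 * norm (z - y)" if "z \<in> S \<inter> range f" for z
      using y that iso[of "?g z" "?g y"] by (auto simp: dist_norm f_inv_into_f)
    then show "\<exists>T B. open T \<and> y \<in> T \<and> (\<forall>z\<in>S \<inter> range f \<inter> T. norm (?g z - ?g y) \<le> B * norm (z - y))"
      by (intro exI[of _ UNIV] exI[of _ 1]) auto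
  qed (use S in \<open>auto intro: negligible_subset\<close>)
  moreover have "f -` S \<subseteq> ?g ` (S \<inter> range f)"
  proof
    fix x assume "x \<in> f -` S"
    then show "x \<in> ?g ` (S \<inter> range f)"
      using inv_f_f[OF inj, of x] by (intro image_eqI[of _ _ "f x"]) auto
  qed
  ultimately show ?thesis by (rule negligible_subset)
qed

text \<open>
  By Vitali's covering theorem an open set is, up to a null set, a countable disjoint union of
  balls.  An isometry pulls balls back to balls of the same radius, and the volume of a ball
  depends on its radius and on the dimension only.
\<close>

lemma lborel_distr_isometry:
  fixes f :: "'a::euclidean_space \<Rightarrow> 'b::euclidean_space"
  assumes iso: "\<And>x y. dist (f x) (f y) = dist x y" and surj: "surj f"
    and dim: "DIM('b) = DIM('a)"
  shows "distr lborel borel f = (lborel :: 'b measure)"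
proof -
  have "continuous_on UNIV f"
    unfolding continuous_on_iff using iso by metis
  then have f [measurable]: "f \<in> borel_measurable borel"
    by (rule borel_measurable_continuous_onI)
  have ball: "f -` ball b r = ball (inv f b) r" for b r
    using surj iso by (auto simp: mem_ball) (metis iso surj_f_inv_f)+
  have box: "emeasure (distr lborel borel f) S = emeasure lborel S" if S: "open S" for S :: "'b set"
  proof -
    define K where "K = {(b, r). r > 0 \<and> ball b r \<subseteq> S}"
    obtain C where C: "countable C" "C \<subseteq> K"
      "pairwise (\<lambda>i j. disjnt (ball (fst i) (snd i)) (ball (fst j) (snd j))) C"
      "negligible (S - (\<Union>i\<in>C. ball (fst i) (snd i)))"
    proof (rule Vitali_covering_theorem_balls[of S K fst snd])
      fix x :: 'b and d :: real assume "x \<in> S" "0 < d"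
      then obtain e where e: "e > 0" "ball x e \<subseteq> S" using S openE by blast
      with \<open>0 < d\<close> have "(x, min e (d/2)) \<in> K" by (auto simp: K_def subset_iff)
      with e \<open>0 < d\<close> show "\<exists>i. i \<in> K \<and> x \<in> ball (fst i) (snd i) \<and> snd i < d"
        by (intro exI[of _ "(x, min e (d/2))"]) auto
    qed
    let ?U = "\<Union>i\<in>C. ball (fst i) (snd i)"
    have US: "?U \<subseteq> S" using C(2) by (auto simp: K_def subset_iff)
    have disj: "disjoint_family_on (\<lambda>i. ball (fst i) (snd i)) C"
      using C(3) by (auto simp: disjoint_family_on_def pairwise_def disjnt_def)
    have Ub [measurable]: "?U \<in> sets borel" by (intro borel_open open_UN) auto
    have Sb [measurable]: "S \<in> sets borel" using S by simp
    have null: "S - ?U \<in> null_sets lborel"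
      using C(4) by (simp add: negligible_iff_null_sets null_sets_completion_iff)
    have "f -` (S - ?U) \<in> null_sets lborel"
    proof -
      have "negligible (f -` (S - ?U))"
        using iso dim C(4) by (intro negligible_isometry_preimage) auto
      moreover have "f -` (S - ?U) \<in> sets borel"
        using measurable_sets[OF f, of "S - ?U"] by auto
      ultimately show ?thesis
        by (simp add: negligible_iff_null_sets null_sets_completion_iff)
    qed
    then have null': "S - ?U \<in> null_sets (distr lborel borel f)"
      by (auto simp: null_sets_distr_iff)
    have "emeasure (distr lborel borel f) ?U = emeasure lborel ?U"
    proof -
      have "emeasure (distr lborel borel f) (ball b r) = emeasure lborel (ball b r)" for b r
        by (cases "r \<ge> 0") (simp_all add: emeasure_distr ball emeasure_ball dim ball_empty)
      then show ?thesis
        using C(1) disj by (subst (1 2) emeasure_UN_countable) auto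
    qed
    moreover have "emeasure M S = emeasure M ?U" if "sets M = sets borel" "S - ?U \<in> null_sets M" for M
    proof -
      have "S = ?U \<union> (S - ?U)" using US by auto
      then show ?thesis using emeasure_Un_null_set[of ?U M "S - ?U"] that Ub by metis
    qed
    ultimately show ?thesis using null null' by simp
  qed
  have "lborel = distr lborel borel f"
  proof (rule lborel_eqI)
    fix l u :: 'b assume "\<And>b. b \<in> Basis \<Longrightarrow> l \<bullet> b \<le> u \<bullet> b"
    then show "emeasure (distr lborel borel f) (box l u) = (\<Prod>b\<in>Basis. (u - l) \<bullet> b)"
      by (simp add: box open_box emeasure_lborel_box)
  qed simp
  then show ?thesis by simp
qed

section \<open>Square means over circles\<close>

text \<open>
  Cauchy's integral formula on the unit circle, parametrized over \<open>{0..1}\<close> so that the parameter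
  measure is a probability measure.
\<close>

lemma circle_mean_value:
  assumes h: "h holomorphic_on S" and S: "open S" "cball 0 1 \<subseteq> S"
  shows "((\<lambda>t. h (exp (2 * of_real pi * \<i> * of_real t))) has_integral h 0) {0..1}"
proof -
  have "((\<lambda>u. h u / (u - 0)) has_contour_integral (2 * of_real pi * \<i> * h 0)) (circlepath 0 1)"
    by (rule Cauchy_integral_circlepath_simple) (use h S in \<open>auto intro: holomorphic_on_subset\<close>)
  then have "((\<lambda>t. 2 * of_real pi * \<i> * h (exp (2 * of_real pi * \<i> * of_real t)))
      has_integral (2 * of_real pi * \<i> * h 0)) {0..1}"
    unfolding has_contour_integral_def
  proof (rule has_integral_cong[THEN iffD1, rotated])
    fix t :: real assume "t \<in> {0..1}"
    then have "vector_derivative (circlepath 0 1) (at t within {0..1}) =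
        2 * of_real pi * \<i> * exp (2 * of_real pi * \<i> * of_real t)"
      by (simp add: vector_derivative_circlepath01)
    then show "h (circlepath 0 1 t) / (circlepath 0 1 t - 0) * vector_derivative (circlepath 0 1) (at t within {0..1})
        = 2 * of_real pi * \<i> * h (exp (2 * of_real pi * \<i> * of_real t))"
      by (simp only:) (simp add: circlepath)
  qed
  then show ?thesis
    by (subst (asm) has_integral_mult_right_iff) simp_all
qed

text \<open>
  With \<open>a = h 0\<close>, integrate the pointwise inequality \<open>2 Re (cnj a * h) - \<bar>a\<bar>\<^sup>2 \<le> \<bar>h\<bar>\<^sup>2\<close> over the
  circle; the mean value property turns the left-hand side into \<open>\<bar>a\<bar>\<^sup>2\<close>.
\<close>

lemma square_le_circle_mean:
  assumes h: "h holomorphic_on S" and S: "open S" "cball 0 1 \<subseteq> S"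
  shows "ennreal ((cmod (h 0))\<^sup>2) \<le>
    (\<integral>\<^sup>+t. ennreal ((cmod (h (exp (2 * of_real pi * \<i> * of_real t))))\<^sup>2 * indicator {0..1} t) \<partial>lborel)"
proof -
  let ?e = "\<lambda>t::real. exp (2 * of_real pi * \<i> * of_real t) :: complex"
  let ?a = "h 0"
  have cont: "continuous_on {0..1} (\<lambda>t. h (?e t))"
    by (rule continuous_on_compose2[OF holomorphic_on_imp_continuous_on[OF h]])
       (use S in \<open>auto intro!: continuous_intros simp: subset_iff\<close>)
  have int: "((\<lambda>t. (cmod (h (?e t)))\<^sup>2) has_integral integral {0..1} (\<lambda>t. (cmod (h (?e t)))\<^sup>2)) {0..1}"
    by (intro integrable_integral integrable_continuous_real continuous_intros cont)
  have "((\<lambda>t. Re (cnj ?a * h (?e t))) has_integral Re (cnj ?a * ?a)) {0..1}"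
    using has_integral_linear[OF has_integral_mult_right[OF circle_mean_value[OF h S], of "cnj ?a"]
      bounded_linear_Re] by (simp add: o_def)
  then have "((\<lambda>t. 2 * Re (cnj ?a * h (?e t)) - (cmod ?a)\<^sup>2) has_integral
      2 * Re (cnj ?a * ?a) - (cmod ?a)\<^sup>2 * (1 - 0)) {0..1}"
    by (intro has_integral_diff has_integral_mult_right) (auto intro: has_integral_const_real[THEN has_integral_eq_rhs])
  moreover have "2 * Re (cnj ?a * ?a) - (cmod ?a)\<^sup>2 * (1 - 0) = (cmod ?a)\<^sup>2"
    unfolding cmod_power2 by (simp add: power2_eq_square)
  ultimately have le: "(cmod ?a)\<^sup>2 \<le> integral {0..1} (\<lambda>t. (cmod (h (?e t)))\<^sup>2)"
  proof (intro has_integral_le[OF _ int])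
    fix t
    have "0 \<le> (cmod (h (?e t) - ?a))\<^sup>2" by simp
    also have "\<dots> = (cmod (h (?e t)))\<^sup>2 - (2 * Re (cnj ?a * h (?e t)) - (cmod ?a)\<^sup>2)"
      unfolding cmod_power2 by (simp add: power2_eq_square algebra_simps)
    finally show "2 * Re (cnj ?a * h (?e t)) - (cmod ?a)\<^sup>2 \<le> (cmod (h (?e t)))\<^sup>2" by simp
  qed simp
  have "ennreal ((cmod ?a)\<^sup>2) \<le> ennreal (integral {0..1} (\<lambda>t. (cmod (h (?e t)))\<^sup>2))"
    using le by (rule ennreal_leI)
  also have "\<dots> = (\<integral>\<^sup>+t. ennreal ((cmod (h (?e t)))\<^sup>2 * indicator {0..1} t) \<partial>lborel)"
    using nn_integral_has_integral_lebesgue[OF _ int] by (simp add: mult.commute)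
  finally show ?thesis .
qed

section \<open>Holomorphic functions and circular retractions\<close>

lemma linear_scale_vector: "linear (\<lambda>c::complex. c *s (v :: complex^'N))"
  by (rule linearI) (simp_all add: vec_eq_iff algebra_simps)

lemma has_field_derivative_along_line:
  fixes f :: "complex^'N \<Rightarrow> complex"
  assumes f: "(f has_derivative f') (at (a + \<zeta> *s v))" and lin: "\<And>c w. f' (c *s w) = c * f' w"
  shows "((\<lambda>\<zeta>. f (a + \<zeta> *s v)) has_field_derivative f' v) (at \<zeta>)"
proof -
  have "((\<lambda>\<zeta>. a + \<zeta> *s v) has_derivative (\<lambda>h. h *s v)) (at \<zeta>)"
    using has_derivative_add[OF has_derivative_const bounded_linear_imp_has_derivative]
      linear_scale_vector[of v] by (fastforce simp: linear_conv_bounded_linear)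
  then have "((\<lambda>\<zeta>. f (a + \<zeta> *s v)) has_derivative (\<lambda>h. f' (h *s v))) (at \<zeta>)"
    using f by (rule has_derivative_compose)
  moreover have "(\<lambda>h. f' (h *s v)) = (*) (f' v)"
    by (simp add: lin fun_eq_iff mult.commute)
  ultimately show ?thesis by (simp add: has_field_derivative_def)
qed

lemma holomorphic_severalE:
  assumes "holomorphic_several f D" "open D" "x \<in> D"
  obtains f' where "(f has_derivative f') (at x)" "\<And>c v. f' (c *s v) = c * f' v"
  using assms at_within_open[of x D] by (fastforce simp: holomorphic_several_def)

lemma holomorphic_severalI:
  assumes "\<And>x. x \<in> D \<Longrightarrow> \<exists>f'. (f has_derivative f') (at x) \<and> (\<forall>c v. f' (c *s v) = c * f' v)"
  shows "holomorphic_several f D"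
  unfolding holomorphic_several_def using assms by (meson has_derivative_at_withinI)

lemma holomorphic_several_line:
  assumes f: "holomorphic_several f D" and D: "open D"
  shows "(\<lambda>\<zeta>. f (a + \<zeta> *s v)) holomorphic_on {\<zeta>. a + \<zeta> *s v \<in> D}"
  unfolding holomorphic_on_def
proof
  fix \<zeta> assume "\<zeta> \<in> {\<zeta>. a + \<zeta> *s v \<in> D}"
  then obtain f' where "(f has_derivative f') (at (a + \<zeta> *s v))" "\<And>c w. f' (c *s w) = c * f' w"
    using holomorphic_severalE[OF f D] by blast
  then have "((\<lambda>\<zeta>. f (a + \<zeta> *s v)) has_field_derivative f' v) (at \<zeta>)"
    by (rule has_field_derivative_along_line)
  then show "(\<lambda>\<zeta>. f (a + \<zeta> *s v)) field_differentiable at \<zeta> within {\<zeta>. a + \<zeta> *s v \<in> D}"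
    by (meson field_differentiable_at_within field_differentiable_def)
qed

lemma holomorphic_several_imp_continuous_on: "holomorphic_several f D \<Longrightarrow> continuous_on D f"
  unfolding holomorphic_several_def continuous_on_eq_continuous_within
  by (meson has_derivative_continuous)

text \<open>
  The map \<open>E\<close> sends a point to the centre about which it is rotated.  Two cases matter: a constant
  map, with the domain a ball around its value, and the projection that puts some coordinates to
  \<open>0\<close>, with a domain that is circular and starlike in these coordinates.
\<close>

definition rotate_about :: "(complex^'N \<Rightarrow> complex^'N) \<Rightarrow> complex \<Rightarrow> complex^'N \<Rightarrow> complex^'N"
  where "rotate_about E \<zeta> x = E x + \<zeta> *s (x - E x)"

definition circular_retraction :: "(complex^'N \<Rightarrow> complex^'N) \<Rightarrow> (complex^'N) set \<Rightarrow> bool"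
  where "circular_retraction E D \<longleftrightarrow>
    continuous_on UNIV E \<and>
    (\<forall>\<zeta> x. E (rotate_about E \<zeta> x) = E x) \<and>
    (\<forall>\<zeta> x y. cmod \<zeta> = 1 \<longrightarrow> dist (rotate_about E \<zeta> x) (rotate_about E \<zeta> y) = dist x y) \<and>
    (\<forall>\<zeta>. \<forall>x\<in>D. cmod \<zeta> \<le> 1 \<longrightarrow> rotate_about E \<zeta> x \<in> D)"

text \<open>
  Composition with a circular retraction is a contraction of the \<open>L\<^sup>2\<close> norm.  On the disc through
  \<open>x\<close> with centre \<open>E x\<close> the function \<open>f\<close> is holomorphic, so \<open>\<bar>f (E x)\<bar>\<^sup>2\<close> is at most the mean of
  \<open>\<bar>f\<bar>\<^sup>2\<close> over the boundary circle.  Integrate over \<open>x\<close> and exchange the integrals: every rotation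
  is an isometry of the domain, hence each rotated copy of \<open>\<bar>f\<bar>\<^sup>2\<close> has the same integral.
\<close>

lemma circular_retraction_nn_integral_le:
  fixes D :: "(complex^'N) set"
  assumes f: "holomorphic_several f D" and D: "open D" and E: "circular_retraction E D"
  shows "(\<integral>\<^sup>+x\<in>D. ennreal ((cmod (f (E x)))\<^sup>2) \<partial>lborel) \<le> (\<integral>\<^sup>+x\<in>D. ennreal ((cmod (f x))\<^sup>2) \<partial>lborel)"
proof -
  define e where "e t = exp (2 * of_real pi * \<i> * of_real t)" for t :: real
  let ?T = "\<lambda>t. rotate_about E (e t)"
  have e1: "cmod (e t) = 1" for t by (simp add: e_def)
  have Econt: "continuous_on UNIV E"
    and EE: "E (rotate_about E \<zeta> x) = E x"
    and iso: "cmod \<zeta> = 1 \<Longrightarrow> dist (rotate_about E \<zeta> x) (rotate_about E \<zeta> y) = dist x y"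
    and inD: "x \<in> D \<Longrightarrow> cmod \<zeta> \<le> 1 \<Longrightarrow> rotate_about E \<zeta> x \<in> D" for \<zeta> x y
    using E by (auto simp: circular_retraction_def)
  have inv: "rotate_about E (cnj \<zeta>) (rotate_about E \<zeta> x) = x" if "cmod \<zeta> = 1" for \<zeta> x
  proof -
    have "cnj \<zeta> * \<zeta> = 1" using that by (metis complex_norm_square mult.commute of_real_1 one_power2)
    then show ?thesis
      using EE[of \<zeta> x] by (simp add: rotate_about_def vector_smult_assoc)
  qed
  have surj: "surj (rotate_about E \<zeta>)" if "cmod \<zeta> = 1" for \<zeta>
    using inv[of "cnj \<zeta>"] that by (intro surjI[of _ "rotate_about E (cnj \<zeta>)"]) simp
  have inD_iff: "?T t x \<in> D \<longleftrightarrow> x \<in> D" for t x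
    using inD[of x "e t"] inD[of "?T t x" "cnj (e t)"] inv[of "e t" x] e1[of t] by auto
  have mean: "ennreal ((cmod (f (E x)))\<^sup>2) * indicator D x \<le>
      (\<integral>\<^sup>+t. ennreal ((cmod (f (?T t x)))\<^sup>2 * indicator {0..1} t) * indicator D x \<partial>lborel)" for x
  proof (cases "x \<in> D")
    case True
    let ?S = "{\<zeta>. E x + \<zeta> *s (x - E x) \<in> D}"
    have "open ?S"
    proof -
      have "continuous_on UNIV (\<lambda>\<zeta>. E x + \<zeta> *s (x - E x))"
        using linear_scale_vector[of "x - E x"]
        by (intro continuous_intros linear_continuous_on) (simp add: linear_conv_bounded_linear)
      from open_vimage[OF D this] show ?thesis by (simp add: vimage_def)
    qed
    moreover have "cball 0 1 \<subseteq> ?S" using inD[OF True] by (auto simp: rotate_about_def)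
    ultimately show ?thesis
      using square_le_circle_mean[OF holomorphic_several_line[OF f D, of "E x" "x - E x"]] True
      by (simp add: rotate_about_def e_def)
  qed simp
  have meas: "(\<lambda>(t, x). ennreal ((cmod (f (?T t x)))\<^sup>2 * indicator {0..1} t) * indicator D x)
      \<in> borel_measurable (lborel \<Otimes>\<^sub>M lborel)"
  proof -
    have "continuous_on (UNIV \<times> D) (\<lambda>(t, x). f (?T t x))"
      unfolding case_prod_beta
    proof (rule continuous_on_compose2[OF holomorphic_several_imp_continuous_on[OF f]])
      have "continuous_on (UNIV \<times> D) (\<lambda>p. E (snd p))"
        by (rule continuous_on_compose2[OF Econt]) (auto intro!: continuous_intros)
      then show "continuous_on (UNIV \<times> D) (\<lambda>p. ?T (fst p) (snd p))"
        unfolding rotate_about_def e_def vector_scalar_mult_def by (intro continuous_intros)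
      show "(\<lambda>p. ?T (fst p) (snd p)) ` (UNIV \<times> D) \<subseteq> D" using inD_iff by auto
    qed
    then have "continuous_on (UNIV \<times> D) (\<lambda>p. (cmod ((\<lambda>(t, x). f (?T t x)) p))\<^sup>2)"
      by (intro continuous_intros)
    then have "(\<lambda>p. indicator (UNIV \<times> D) p *\<^sub>R (cmod ((\<lambda>(t, x). f (?T t x)) p))\<^sup>2) \<in> borel_measurable borel"
      by (rule borel_measurable_continuous_on_indicator[rotated]) (auto intro!: borel_open open_Times D)
    then have [measurable]: "(\<lambda>p. indicator (UNIV \<times> D) p *\<^sub>R (cmod ((\<lambda>(t, x). f (?T t x)) p))\<^sup>2)
        \<in> borel_measurable (lborel \<Otimes>\<^sub>M lborel)"
      by (simp add: lborel_prod)
    have "(\<lambda>(t, x). ennreal ((cmod (f (?T t x)))\<^sup>2 * indicator {0..1} t) * indicator D x) =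
      (\<lambda>p. ennreal (indicator (UNIV \<times> D) p *\<^sub>R (cmod ((\<lambda>(t, x). f (?T t x)) p))\<^sup>2) * indicator {0..1} (fst p))"
      by (auto simp: fun_eq_iff indicator_def)
    also have "\<dots> \<in> borel_measurable (lborel \<Otimes>\<^sub>M lborel)" by measurable
    finally show ?thesis .
  qed
  have rot: "(\<integral>\<^sup>+x. ennreal ((cmod (f (?T t x)))\<^sup>2) * indicator D x \<partial>lborel) =
      (\<integral>\<^sup>+x\<in>D. ennreal ((cmod (f x))\<^sup>2) \<partial>lborel)" for t
  proof -
    have [measurable]: "?T t \<in> borel_measurable borel"
    proof (rule borel_measurable_continuous_onI)
      show "continuous_on UNIV (?T t)"
        unfolding continuous_on_iff using iso[OF e1] by metis
    qed
    have "(\<lambda>x. indicator D x *\<^sub>R (cmod (f x))\<^sup>2) \<in> borel_measurable borel"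
      by (intro borel_measurable_continuous_on_indicator continuous_intros
          holomorphic_several_imp_continuous_on[OF f] borel_open D)
    then have [measurable]: "(\<lambda>x. ennreal (indicator D x *\<^sub>R (cmod (f x))\<^sup>2)) \<in> borel_measurable borel"
      by measurable
    have "(\<integral>\<^sup>+x\<in>D. ennreal ((cmod (f x))\<^sup>2) \<partial>lborel) =
        (\<integral>\<^sup>+x. ennreal (indicator D x *\<^sub>R (cmod (f x))\<^sup>2) \<partial>distr lborel borel (?T t))"
      using lborel_distr_isometry[OF iso[OF e1] surj[OF e1]]
      by (auto intro!: nn_integral_cong simp: indicator_def)
    also have "\<dots> = (\<integral>\<^sup>+x. ennreal (indicator D (?T t x) *\<^sub>R (cmod (f (?T t x)))\<^sup>2) \<partial>lborel)"
      by (rule nn_integral_distr) measurable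
    also have "\<dots> = (\<integral>\<^sup>+x. ennreal ((cmod (f (?T t x)))\<^sup>2) * indicator D x \<partial>lborel)"
      by (intro nn_integral_cong) (auto simp: indicator_def inD_iff)
    finally show ?thesis by simp
  qed
  have "(\<integral>\<^sup>+x\<in>D. ennreal ((cmod (f (E x)))\<^sup>2) \<partial>lborel) \<le>
      (\<integral>\<^sup>+x. (\<integral>\<^sup>+t. ennreal ((cmod (f (?T t x)))\<^sup>2 * indicator {0..1} t) * indicator D x \<partial>lborel) \<partial>lborel)"
    by (intro nn_integral_mono mean)
  also have "\<dots> = (\<integral>\<^sup>+t. (\<integral>\<^sup>+x. ennreal ((cmod (f (?T t x)))\<^sup>2 * indicator {0..1} t) * indicator D x \<partial>lborel) \<partial>lborel)"
    using lborel_pair.Fubini'[OF meas] by simp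
  also have "\<dots> = (\<integral>\<^sup>+t. (\<integral>\<^sup>+x\<in>D. ennreal ((cmod (f x))\<^sup>2) \<partial>lborel) * indicator {0..1} (t::real) \<partial>lborel)"
  proof (intro nn_integral_cong)
    fix t
    show "(\<integral>\<^sup>+x. ennreal ((cmod (f (?T t x)))\<^sup>2 * indicator {0..1} t) * indicator D x \<partial>lborel) =
        (\<integral>\<^sup>+x\<in>D. ennreal ((cmod (f x))\<^sup>2) \<partial>lborel) * indicator {0..1} t"
      using rot[of t] by (cases "t \<in> {0..1}") simp_all
  qed
  also have "\<dots> = (\<integral>\<^sup>+x\<in>D. ennreal ((cmod (f x))\<^sup>2) \<partial>lborel)"
    by (simp add: nn_integral_cmult_indicator)
  finally show ?thesis .
qed

section \<open>The Bergman space\<close>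

lemma holomorphic_several_add:
  assumes f: "holomorphic_several f D" and g: "holomorphic_several g D" and D: "open D"
  shows "holomorphic_several (\<lambda>x. f x + g x) D"
proof (rule holomorphic_severalI)
  fix x assume x: "x \<in> D"
  obtain f' where f': "(f has_derivative f') (at x)" "\<And>c v. f' (c *s v) = c * f' v"
    using holomorphic_severalE[OF f D x] by blast
  obtain g' where g': "(g has_derivative g') (at x)" "\<And>c v. g' (c *s v) = c * g' v"
    using holomorphic_severalE[OF g D x] by blast
  show "\<exists>h'. ((\<lambda>x. f x + g x) has_derivative h') (at x) \<and> (\<forall>c v. h' (c *s v) = c * h' v)"
    using has_derivative_add[OF f'(1) g'(1)] f'(2) g'(2)
    by (intro exI[of _ "\<lambda>v. f' v + g' v"]) (simp add: algebra_simps)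
qed

lemma holomorphic_several_mult_left:
  assumes f: "holomorphic_several f D" and D: "open D"
  shows "holomorphic_several (\<lambda>x. a * f x) D"
proof (rule holomorphic_severalI)
  fix x assume x: "x \<in> D"
  obtain f' where f': "(f has_derivative f') (at x)" "\<And>c v. f' (c *s v) = c * f' v"
    using holomorphic_severalE[OF f D x] by blast
  show "\<exists>h'. ((\<lambda>x. a * f x) has_derivative h') (at x) \<and> (\<forall>c v. h' (c *s v) = c * h' v)"
    using has_derivative_mult_right[OF f'(1), of a] f'(2)
    by (intro exI[of _ "\<lambda>v. a * f' v"]) (simp add: algebra_simps)
qed

lemma holomorphic_several_diff:
  assumes "holomorphic_several f D" "holomorphic_several g D" "open D"
  shows "holomorphic_several (\<lambda>x. f x - g x) D"
  using holomorphic_several_add[OF assms(1) holomorphic_several_mult_left[OF assms(2,3), of "-1"] assms(3)]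
  by simp

definition complex_linear :: "(complex^'M \<Rightarrow> complex^'N) \<Rightarrow> bool"
  where "complex_linear A \<longleftrightarrow> linear A \<and> (\<forall>c v. A (c *s v) = c *s A v)"

lemma holomorphic_several_compose_linear:
  assumes f: "holomorphic_several f D" and D: "open D" and A: "complex_linear A"
    and sub: "A ` D' \<subseteq> D"
  shows "holomorphic_several (\<lambda>x. f (A x)) D'"
proof (rule holomorphic_severalI)
  fix x assume x: "x \<in> D'"
  obtain f' where f': "(f has_derivative f') (at (A x))" "\<And>c v. f' (c *s v) = c * f' v"
    using holomorphic_severalE[OF f D, of "A x"] x sub by blast
  have "(A has_derivative A) (at x)"
    using A by (simp add: complex_linear_def linear_conv_bounded_linear bounded_linear_imp_has_derivative)
  from has_derivative_compose[OF this f'(1)]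
  show "\<exists>h'. ((\<lambda>x. f (A x)) has_derivative h') (at x) \<and> (\<forall>c v. h' (c *s v) = c * h' v)"
    using A f'(2) by (intro exI[of _ "\<lambda>v. f' (A v)"]) (simp add: complex_linear_def)
qed

definition square_norm :: "(complex^'N) set \<Rightarrow> (complex^'N \<Rightarrow> complex) \<Rightarrow> real"
  where "square_norm D f = (LINT x:D|lborel. (cmod (f x))\<^sup>2)"

lemma bergman_space_iff:
  assumes D: "open D"
  shows "f \<in> bergman_space D \<longleftrightarrow>
    holomorphic_several f D \<and> (\<integral>\<^sup>+x\<in>D. ennreal ((cmod (f x))\<^sup>2) \<partial>lborel) < \<infinity>"
proof (cases "holomorphic_several f D")
  case True
  have "(\<lambda>x. indicator D x *\<^sub>R (cmod (f x))\<^sup>2) \<in> borel_measurable borel"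
    by (intro borel_measurable_continuous_on_indicator continuous_intros
          holomorphic_several_imp_continuous_on[OF True] borel_open D)
  then show ?thesis using True
    by (simp add: bergman_space_def set_integrable_def integrable_iff_bounded ennreal_mult' mult.commute
        ennreal_indicator)
qed (simp add: bergman_space_def)

lemma nn_integral_eq_square_norm:
  assumes f: "f \<in> bergman_space D"
  shows "(\<integral>\<^sup>+x\<in>D. ennreal ((cmod (f x))\<^sup>2) \<partial>lborel) = ennreal (square_norm D f)"
proof -
  have "(\<integral>\<^sup>+x. ennreal (indicator D x *\<^sub>R (cmod (f x))\<^sup>2) \<partial>lborel) = ennreal (square_norm D f)"
    using f unfolding square_norm_def set_lebesgue_integral_def bergman_space_def set_integrable_def
    by (intro nn_integral_eq_integral) auto
  then show ?thesis by (simp add: ennreal_mult' mult.commute ennreal_indicator)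
qed

lemma square_norm_nonneg: "square_norm D f \<ge> 0"
  unfolding square_norm_def set_lebesgue_integral_def by (intro integral_nonneg_AE) simp

lemma bergman_space_holomorphic: "f \<in> bergman_space D \<Longrightarrow> holomorphic_several f D"
  by (simp add: bergman_space_def)

lemma L2_inner_integrable:
  assumes D: "open D" and f: "f \<in> bergman_space D" and g: "g \<in> bergman_space D"
  shows "set_integrable lborel D (\<lambda>x. f x * cnj (g x))"
  unfolding set_integrable_def
proof (rule Bochner_Integration.integrable_bound)
  show "integrable lborel (\<lambda>x. indicator D x *\<^sub>R (cmod (f x))\<^sup>2 + indicator D x *\<^sub>R (cmod (g x))\<^sup>2)"
    using f g by (intro Bochner_Integration.integrable_add) (auto simp: bergman_space_def set_integrable_def)
  show "(\<lambda>x. indicator D x *\<^sub>R (f x * cnj (g x))) \<in> borel_measurable lborel"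
    using borel_measurable_continuous_on_indicator[of D "\<lambda>x. f x * cnj (g x)"] D
      holomorphic_several_imp_continuous_on[OF bergman_space_holomorphic[OF f]]
      holomorphic_several_imp_continuous_on[OF bergman_space_holomorphic[OF g]]
    by (simp add: continuous_intros)
  have "cmod (f x) * cmod (g x) \<le> (cmod (f x))\<^sup>2 + (cmod (g x))\<^sup>2" for x
  proof -
    have "0 \<le> cmod (f x) * cmod (g x)" by simp
    then show ?thesis
      using sum_squares_bound[of "cmod (f x)" "cmod (g x)"] unfolding mult.assoc by linarith
  qed
  then show "AE x in lborel. norm (indicator D x *\<^sub>R (f x * cnj (g x))) \<le>
      norm (indicator D x *\<^sub>R (cmod (f x))\<^sup>2 + indicator D x *\<^sub>R (cmod (g x))\<^sup>2)"
    by (auto simp: indicator_def norm_mult)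
qed

lemma L2_inner_self: "L2_inner D f f = of_real (square_norm D f)"
proof -
  have "(\<lambda>x. indicator D x *\<^sub>R (f x * cnj (f x))) = (\<lambda>x. complex_of_real (indicator D x *\<^sub>R (cmod (f x))\<^sup>2))"
  proof
    fix x
    show "indicator D x *\<^sub>R (f x * cnj (f x)) = complex_of_real (indicator D x *\<^sub>R (cmod (f x))\<^sup>2)"
      by (cases "x \<in> D") (simp_all add: complex_norm_square[symmetric] del: of_real_power)
  qed
  then show ?thesis
    unfolding L2_inner_def square_norm_def set_lebesgue_integral_def by (simp only: integral_complex_of_real)
qed

lemma bergman_space_subspace:
  assumes D: "open D"
  shows "(\<lambda>x. 0) \<in> bergman_space D"
    and "f \<in> bergman_space D \<Longrightarrow> (\<lambda>x. c * f x) \<in> bergman_space D"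
    and "\<lbrakk>f \<in> bergman_space D; g \<in> bergman_space D\<rbrakk> \<Longrightarrow> (\<lambda>x. f x + g x) \<in> bergman_space D"
proof -
  show "(\<lambda>x. 0) \<in> bergman_space D"
    unfolding bergman_space_def holomorphic_several_def
    by (auto intro!: exI[of _ "\<lambda>_. 0"] simp: set_integrable_def)
  show "(\<lambda>x. c * f x) \<in> bergman_space D" if "f \<in> bergman_space D"
    using that D unfolding bergman_space_def
    by (auto intro!: holomorphic_several_mult_left simp: norm_mult power_mult_distrib)
  assume f: "f \<in> bergman_space D" and g: "g \<in> bergman_space D"
  have "set_integrable lborel D (\<lambda>x. (cmod (f x + g x))\<^sup>2)"
    unfolding set_integrable_def
  proof (rule Bochner_Integration.integrable_bound)
    show "integrable lborel (\<lambda>x. 2 * (indicator D x *\<^sub>R (cmod (f x))\<^sup>2) + 2 * (indicator D x *\<^sub>R (cmod (g x))\<^sup>2))"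
      using f g by (intro Bochner_Integration.integrable_add integrable_mult_right)
        (auto simp: bergman_space_def set_integrable_def)
    show "(\<lambda>x. indicator D x *\<^sub>R (cmod (f x + g x))\<^sup>2) \<in> borel_measurable lborel"
      using borel_measurable_continuous_on_indicator[of D "\<lambda>x. (cmod (f x + g x))\<^sup>2"] D
        holomorphic_several_imp_continuous_on[OF bergman_space_holomorphic[OF f]]
        holomorphic_several_imp_continuous_on[OF bergman_space_holomorphic[OF g]]
      by (simp add: continuous_intros)
    have "(cmod (a + b))\<^sup>2 \<le> 2 * (cmod a)\<^sup>2 + 2 * (cmod b)\<^sup>2" for a b
    proof -
      have "(cmod (a + b))\<^sup>2 \<le> (cmod a + cmod b)\<^sup>2" by (intro power_mono norm_triangle_ineq) simp
      also have "\<dots> \<le> 2 * (cmod a)\<^sup>2 + 2 * (cmod b)\<^sup>2"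
        using sum_squares_bound[of "cmod a" "cmod b"] by (simp add: power2_sum)
      finally show ?thesis .
    qed
    then show "AE x in lborel. norm (indicator D x *\<^sub>R (cmod (f x + g x))\<^sup>2) \<le>
      norm (2 * (indicator D x *\<^sub>R (cmod (f x))\<^sup>2) + 2 * (indicator D x *\<^sub>R (cmod (g x))\<^sup>2))"
      by (auto simp: indicator_def)
  qed
  then show "(\<lambda>x. f x + g x) \<in> bergman_space D"
    using holomorphic_several_add[OF bergman_space_holomorphic[OF f] bergman_space_holomorphic[OF g] D]
    by (simp add: bergman_space_def)
qed

lemma bergman_space_diff:
  assumes "open D" "f \<in> bergman_space D" "g \<in> bergman_space D"
  shows "(\<lambda>x. f x - g x) \<in> bergman_space D"
  using bergman_space_subspace(3)[OF assms(1,2) bergman_space_subspace(2)[OF assms(1,3), of "-1"]] by simp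

section \<open>Point evaluations\<close>

lemma norm_scale_vector: "norm (c *s (v :: complex^'N)) = cmod c * norm v"
  by (simp add: norm_vec_def norm_mult L2_set_right_distrib)

lemma circular_retraction_ball: "circular_retraction (\<lambda>_. a) (ball a r)"
proof -
  have scale: "dist (rotate_about (\<lambda>_. a) \<zeta> x) (rotate_about (\<lambda>_. a) \<zeta> y) = cmod \<zeta> * dist x y" for \<zeta> x y
    by (simp add: rotate_about_def dist_norm norm_scale_vector flip: vector_ssub_ldistrib)
  moreover have "rotate_about (\<lambda>_. a) \<zeta> a = a" for \<zeta> by (simp add: rotate_about_def)
  ultimately have "dist a (rotate_about (\<lambda>_. a) \<zeta> x) = cmod \<zeta> * dist a x" for \<zeta> x by metis
  moreover have "cmod \<zeta> * dist a x < r" if "cmod \<zeta> \<le> 1" "dist a x < r" for \<zeta> x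
    using that mult_right_mono[of "cmod \<zeta>" 1 "dist a x"] by simp
  ultimately show ?thesis
    using scale by (auto simp: circular_retraction_def)
qed

text \<open>
  This is the contraction property for the retraction of the ball to its centre, where the
  left-hand integrand is constant.
\<close>

lemma square_le_mean_over_ball:
  assumes f: "f \<in> bergman_space D" and D: "open D" and r: "r > 0" "ball x r \<subseteq> D"
  shows "(cmod (f x))\<^sup>2 \<le> square_norm D f / measure lborel (ball x r)"
proof -
  have "holomorphic_several f (ball x r)"
  proof (rule holomorphic_severalI)
    fix y assume "y \<in> ball x r"
    then have "y \<in> D" using r(2) by blast
    then show "\<exists>f'. (f has_derivative f') (at y) \<and> (\<forall>c v. f' (c *s v) = c * f' v)"
      using holomorphic_severalE[OF bergman_space_holomorphic[OF f] D] by metis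
  qed
  then have "(\<integral>\<^sup>+y\<in>ball x r. ennreal ((cmod (f x))\<^sup>2) \<partial>lborel) \<le> (\<integral>\<^sup>+y\<in>ball x r. ennreal ((cmod (f y))\<^sup>2) \<partial>lborel)"
    using circular_retraction_nn_integral_le[OF _ open_ball circular_retraction_ball] by blast
  also have "\<dots> \<le> (\<integral>\<^sup>+y\<in>D. ennreal ((cmod (f y))\<^sup>2) \<partial>lborel)"
    using r by (intro nn_integral_mono) (auto simp: indicator_def)
  also have "\<dots> = ennreal (square_norm D f)" by (rule nn_integral_eq_square_norm[OF f])
  also have "(\<integral>\<^sup>+y\<in>ball x r. ennreal ((cmod (f x))\<^sup>2) \<partial>lborel) = ennreal ((cmod (f x))\<^sup>2 * measure lborel (ball x r))"
    using emeasure_eq_ennreal_measure[of lborel "ball x r"] emeasure_lborel_ball_finite[of x r]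
    by (simp add: nn_integral_cmult_indicator ennreal_mult' less_top)
  finally show ?thesis
    using r content_ball_pos[of r x] square_norm_nonneg[of D f] by (simp add: field_simps)
qed

text \<open>
  Near \<open>x0\<close> balls of one fixed radius fit into the domain, which makes the bound on evaluation
  locally uniform.
\<close>

lemma locally_bounded_evaluation:
  fixes D :: "(complex^'N) set"
  assumes D: "open D" and x0: "x0 \<in> D"
  obtains r C where "r > 0" "C > 0" "ball x0 r \<subseteq> D"
    "\<And>x f. \<lbrakk>x \<in> ball x0 r; f \<in> bergman_space D\<rbrakk> \<Longrightarrow> (cmod (f x))\<^sup>2 \<le> C * square_norm D f"
proof -
  obtain e where e: "e > 0" "ball x0 e \<subseteq> D" using D x0 openE by blast
  define r where "r = e / 2"
  have r: "r > 0" "ball x0 r \<subseteq> D" using e by (auto simp: r_def)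
  show ?thesis
  proof (rule that[of r "1 / measure lborel (ball x0 r)"])
    fix x f assume x: "x \<in> ball x0 r" and f: "f \<in> bergman_space D"
    have "ball x r \<subseteq> ball x0 e"
    proof
      fix y assume "y \<in> ball x r"
      then show "y \<in> ball x0 e" using x dist_triangle[of x0 y x] by (simp add: r_def)
    qed
    then have "(cmod (f x))\<^sup>2 \<le> square_norm D f / measure lborel (ball x r)"
      using e by (intro square_le_mean_over_ball[OF f D r(1)]) auto
    then show "(cmod (f x))\<^sup>2 \<le> 1 / measure lborel (ball x0 r) * square_norm D f"
      using r by (simp add: content_ball)
  qed (use r content_ball_pos[OF r(1)] in auto)
qed

text \<open>
  Cauchy's estimate on the disc of radius \<open>r / 4\<close> around \<open>x\<close> in the complex line with direction \<open>v\<close>.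
  This disc stays inside \<open>ball x0 r\<close> because \<open>x\<close> lies in the concentric ball of half the radius.
\<close>

lemma derivative_bound:
  assumes f: "holomorphic_several f (ball x0 r)" and r: "r > 0" and x: "x \<in> ball x0 (r/2)"
    and M: "\<And>y. y \<in> ball x0 r \<Longrightarrow> cmod (f y) \<le> M"
    and f': "(f has_derivative f') (at x)" "\<And>c v. f' (c *s v) = c * f' v"
  shows "cmod (f' v) \<le> 4 / r * M * norm v"
proof (cases "v = 0")
  case True
  then show ?thesis using f'(2)[of 0 0] by simp
next
  case False
  define \<rho> where "\<rho> = r / (4 * norm v)"
  have \<rho>: "\<rho> > 0" "\<rho> * norm v = r / 4" using False r by (simp_all add: \<rho>_def)
  have sub: "x + \<zeta> *s v \<in> ball x0 r" if "\<zeta> \<in> cball 0 \<rho>" for \<zeta>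
  proof -
    have "cmod \<zeta> * norm v \<le> r / 4"
      using that mult_right_mono[of "cmod \<zeta>" \<rho> "norm v"] \<rho>(2) by simp
    then have "dist x (x + \<zeta> *s v) \<le> r / 4" by (simp add: dist_norm norm_scale_vector)
    then show ?thesis using x r dist_triangle[of x0 "x + \<zeta> *s v" x] by simp
  qed
  let ?h = "\<lambda>\<zeta>. f (x + \<zeta> *s v)"
  have hol: "?h holomorphic_on cball 0 \<rho>"
    using holomorphic_several_line[OF f open_ball] by (rule holomorphic_on_subset) (use sub in auto)
  have "cmod ((deriv ^^ 1) ?h 0) \<le> fact 1 * M / \<rho> ^ 1"
  proof (rule Cauchy_inequality)
    show "cmod (?h \<zeta>) \<le> M" if "cmod (0 - \<zeta>) = \<rho>" for \<zeta>
      using that by (intro M sub) simp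
  qed (use hol \<rho> in \<open>auto intro: holomorphic_on_subset holomorphic_on_imp_continuous_on\<close>)
  moreover have "deriv ?h 0 = f' v"
    by (rule DERIV_imp_deriv, rule has_field_derivative_along_line) (use f' in auto)
  ultimately show ?thesis by (simp add: \<rho>_def field_simps)
qed

section \<open>Completeness of the Bergman space\<close>

lemma evaluation_less_if_square_norm_less:
  assumes bound: "\<And>f. f \<in> bergman_space D \<Longrightarrow> (cmod (L f))\<^sup>2 \<le> C * square_norm D f" and C: "C > 0"
    and e: "e > 0" and f: "f \<in> bergman_space D" and small: "square_norm D f < e\<^sup>2 / C"
  shows "cmod (L f) < e"
proof -
  have "(cmod (L f))\<^sup>2 < e\<^sup>2"
    using bound[OF f] small C by (simp add: field_simps)
  then show ?thesis using e by (simp add: power_less_imp_less_base)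
qed

text \<open>
  Convergence in square norm controls the functions and, by Cauchy's estimate on complex lines,
  their derivatives uniformly near every point, so the pointwise limit is again holomorphic.
\<close>

proposition holomorphic_limit:
  fixes F :: "nat \<Rightarrow> complex^'N \<Rightarrow> complex"
  assumes D: "open D" and F: "\<And>n. F n \<in> bergman_space D"
    and cau: "\<And>e. e > 0 \<Longrightarrow> \<exists>N. \<forall>m\<ge>N. \<forall>n\<ge>N. square_norm D (\<lambda>x. F m x - F n x) < e"
  shows "holomorphic_several (\<lambda>x. lim (\<lambda>n. F n x)) D" "\<And>x. x \<in> D \<Longrightarrow> (\<lambda>n. F n x) \<longlonglongrightarrow> lim (\<lambda>n. F n x)"
proof -
  have hol: "holomorphic_several (F n) D" for n using F by (rule bergman_space_holomorphic)
  have diff: "(\<lambda>x. F m x - F n x) \<in> bergman_space D" for m n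
    using bergman_space_diff[OF D F F] .
  have "(\<lambda>n. F n x0) \<longlonglongrightarrow> lim (\<lambda>n. F n x0) \<and>
      (\<exists>f'. ((\<lambda>x. lim (\<lambda>n. F n x)) has_derivative f') (at x0) \<and> (\<forall>c v. f' (c *s v) = c * f' v))"
    if x0: "x0 \<in> D" for x0
  proof -
    obtain r C where r: "r > 0" "C > 0" "ball x0 r \<subseteq> D"
      and ev: "\<And>x f. \<lbrakk>x \<in> ball x0 r; f \<in> bergman_space D\<rbrakk> \<Longrightarrow> (cmod (f x))\<^sup>2 \<le> C * square_norm D f"
      using locally_bounded_evaluation[OF D x0] by metis
    have unif: "\<exists>N. \<forall>m\<ge>N. \<forall>n\<ge>N. \<forall>x\<in>ball x0 r. cmod (F m x - F n x) < e" if e: "e > 0" for e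
    proof -
      have "e\<^sup>2 / C > 0" using e r by simp
      then obtain N where N: "\<And>m n. m \<ge> N \<Longrightarrow> n \<ge> N \<Longrightarrow> square_norm D (\<lambda>x. F m x - F n x) < e\<^sup>2 / C"
        using cau by metis
      have "cmod (F m x - F n x) < e" if "m \<ge> N" "n \<ge> N" "x \<in> ball x0 r" for m n x
        using evaluation_less_if_square_norm_less[of D "\<lambda>f. f x", OF ev[OF that(3)] r(2) e diff N]
          that by simp
      then show ?thesis by blast
    qed
    define S where "S = ball x0 (r/2)"
    have S: "S \<subseteq> ball x0 r" "S \<subseteq> D" "x0 \<in> S" "open S" "convex S" using r by (auto simp: S_def)
    define F' where "F' n x = (SOME f'. (F n has_derivative f') (at x) \<and> (\<forall>c v. f' (c *s v) = c * f' v))" for n x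
    have "(F n has_derivative F' n x) (at x) \<and> (\<forall>c v. F' n x (c *s v) = c * F' n x v)" if "x \<in> S" for n x
    proof -
      have "x \<in> D" using that S by blast
      then have "\<exists>f'. (F n has_derivative f') (at x) \<and> (\<forall>c v. f' (c *s v) = c * f' v)"
        using holomorphic_severalE[OF hol[of n] D] by metis
      from someI_ex[OF this] show ?thesis unfolding F'_def .
    qed
    then have F': "\<And>n x. x \<in> S \<Longrightarrow> (F n has_derivative F' n x) (at x)"
      "\<And>n x c v. x \<in> S \<Longrightarrow> F' n x (c *s v) = c * F' n x v" by blast+
    have unif': "\<exists>N. \<forall>m\<ge>N. \<forall>n\<ge>N. \<forall>x\<in>S. \<forall>v. cmod (F' m x v - F' n x v) \<le> e * norm v" if e: "e > 0" for e
    proof -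
      obtain N where N: "\<And>m n x. \<lbrakk>m \<ge> N; n \<ge> N; x \<in> ball x0 r\<rbrakk> \<Longrightarrow> cmod (F m x - F n x) < e * r / 4"
      proof -
        have "e * r / 4 > 0" using e r by simp
        from unif[OF this] show ?thesis using that by blast
      qed
      have "cmod (F' m x v - F' n x v) \<le> e * norm v" if mn: "m \<ge> N" "n \<ge> N" and x: "x \<in> S" for m n x v
      proof -
        have "cmod (F' m x v - F' n x v) \<le> 4 / r * (e * r / 4) * norm v"
        proof (rule derivative_bound[of "\<lambda>x. F m x - F n x" x0 r x "e * r / 4" "\<lambda>v. F' m x v - F' n x v"])
          show "holomorphic_several (\<lambda>x. F m x - F n x) (ball x0 r)"
          proof (rule holomorphic_severalI)
            fix y assume "y \<in> ball x0 r"
            then have "y \<in> D" using r(3) by blast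
            then show "\<exists>f'. ((\<lambda>x. F m x - F n x) has_derivative f') (at y) \<and> (\<forall>c v. f' (c *s v) = c * f' v)"
              using holomorphic_severalE[OF bergman_space_holomorphic[OF diff] D] by metis
          qed
          show "((\<lambda>x. F m x - F n x) has_derivative (\<lambda>v. F' m x v - F' n x v)) (at x)"
            using F'(1)[OF x] by (intro has_derivative_diff)
          show "cmod (F m y - F n y) \<le> e * r / 4" if "y \<in> ball x0 r" for y
            using N[OF mn that] by simp
        qed (use r x F'(2)[OF x] in \<open>auto simp: S_def algebra_simps\<close>)
        then show ?thesis using r by simp
      qed
      then show ?thesis by blast
    qed
    have lim': "(\<lambda>n. F' n x v) \<longlonglongrightarrow> lim (\<lambda>n. F' n x v)" if x: "x \<in> S" for x v
    proof -
      have "Cauchy (\<lambda>n. F' n x v)"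
      proof (rule CauchyI)
        fix e :: real assume "e > 0"
        then have "e / (norm v + 1) > 0" by (simp add: add_nonneg_pos)
        then obtain N where N: "\<And>m n. \<lbrakk>m \<ge> N; n \<ge> N\<rbrakk> \<Longrightarrow> cmod (F' m x v - F' n x v) \<le> e / (norm v + 1) * norm v"
          using unif' x by meson
        have "e / (norm v + 1) * norm v < e"
        proof -
          have "0 < norm v + 1" by (simp add: add_nonneg_pos)
          then have "e * norm v / (norm v + 1) < e"
            using \<open>e > 0\<close> by (simp add: pos_divide_less_eq)
          then show ?thesis by simp
        qed
        then show "\<exists>M. \<forall>m\<ge>M. \<forall>n\<ge>M. norm (F' m x v - F' n x v) < e"
          using N by (meson order.strict_trans1)
      qed
      then show ?thesis by (simp add: Cauchy_convergent convergent_LIMSEQ_iff[symmetric])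
    qed
    define G' where "G' x v = lim (\<lambda>n. F' n x v)" for x v
    have unifG: "\<forall>\<^sub>F n in sequentially. \<forall>x\<in>S. \<forall>v. norm (F' n x v - G' x v) \<le> e * norm v" if e: "e > 0" for e
    proof -
      obtain N where N: "\<And>m n x v. \<lbrakk>m \<ge> N; n \<ge> N; x \<in> S\<rbrakk> \<Longrightarrow> cmod (F' m x v - F' n x v) \<le> e * norm v"
        using unif'[OF e] by meson
      have "norm (F' n x v - G' x v) \<le> e * norm v" if n: "n \<ge> N" and x: "x \<in> S" for n x v
      proof (rule tendsto_le[OF _ tendsto_const])
        show "(\<lambda>m. cmod (F' n x v - F' m x v)) \<longlonglongrightarrow> cmod (F' n x v - G' x v)"
          unfolding G'_def by (intro tendsto_intros lim'[OF x])
        show "\<forall>\<^sub>F m in sequentially. cmod (F' n x v - F' m x v) \<le> e * norm v"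
          using N[OF n _ x] by (auto simp: eventually_sequentially)
      qed simp
      then show ?thesis by (auto simp: eventually_sequentially)
    qed
    have "Cauchy (\<lambda>n. F n x0)"
    proof (rule CauchyI)
      fix e :: real assume "e > 0"
      then show "\<exists>M. \<forall>m\<ge>M. \<forall>n\<ge>M. norm (F m x0 - F n x0) < e"
        using unif r(1) by (meson centre_in_ball)
    qed
    then have lim0: "(\<lambda>n. F n x0) \<longlonglongrightarrow> lim (\<lambda>n. F n x0)"
      by (simp add: Cauchy_convergent convergent_LIMSEQ_iff[symmetric])
    obtain g where g: "\<And>x. x \<in> S \<Longrightarrow> (\<lambda>n. F n x) \<longlonglongrightarrow> g x"
      "\<And>x. x \<in> S \<Longrightarrow> (g has_derivative G' x) (at x within S)"
    proof -
      have "\<exists>g. \<forall>x\<in>S. (\<lambda>n. F n x) \<longlonglongrightarrow> g x \<and> (g has_derivative G' x) (at x within S)"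
        by (rule has_derivative_sequence[of S F F' G' x0, OF S(5) _ unifG S(3) lim0])
           (auto intro: has_derivative_at_withinI F'(1))
      then show ?thesis using that by blast
    qed
    have "(g has_derivative G' x0) (at x0)"
      using g(2)[OF S(3)] at_within_open[OF S(3,4)] by simp
    then have "((\<lambda>x. lim (\<lambda>n. F n x)) has_derivative G' x0) (at x0)"
      by (rule has_derivative_transform_within_open[OF _ S(4,3)]) (simp add: limI[OF g(1)])
    moreover have "G' x0 (c *s v) = c * G' x0 v" for c v
    proof -
      have "(\<lambda>n. c * F' n x0 v) \<longlonglongrightarrow> c * G' x0 v"
        unfolding G'_def by (intro tendsto_intros lim'[OF S(3)])
      then have "(\<lambda>n. F' n x0 (c *s v)) \<longlonglongrightarrow> c * G' x0 v" by (simp add: F'(2)[OF S(3)])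
      then show ?thesis unfolding G'_def by (rule limI)
    qed
    ultimately show ?thesis using lim0 by blast
  qed
  then show "holomorphic_several (\<lambda>x. lim (\<lambda>n. F n x)) D" "\<And>x. x \<in> D \<Longrightarrow> (\<lambda>n. F n x) \<longlonglongrightarrow> lim (\<lambda>n. F n x)"
    by (auto intro: holomorphic_severalI)
qed

text \<open>
  Fatou's lemma transfers the Cauchy property from the differences \<open>F n - F m\<close> to \<open>F n - g\<close>, where
  \<open>g\<close> is the pointwise limit.
\<close>

proposition bergman_space_complete:
  fixes F :: "nat \<Rightarrow> complex^'N \<Rightarrow> complex"
  assumes D: "open D" and F: "\<And>n. F n \<in> bergman_space D"
    and cau: "\<And>e. e > 0 \<Longrightarrow> \<exists>N. \<forall>m\<ge>N. \<forall>n\<ge>N. square_norm D (\<lambda>x. F m x - F n x) < e"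
  obtains g where "g \<in> bergman_space D" "(\<lambda>n. square_norm D (\<lambda>x. F n x - g x)) \<longlonglongrightarrow> 0"
proof -
  define g where "g x = lim (\<lambda>n. F n x)" for x
  have hol: "holomorphic_several g D" and lim: "\<And>x. x \<in> D \<Longrightarrow> (\<lambda>n. F n x) \<longlonglongrightarrow> g x"
    using holomorphic_limit[OF D F cau] by (simp_all add: g_def[abs_def])
  have diff: "(\<lambda>x. F m x - F n x) \<in> bergman_space D" for m n
    using bergman_space_diff[OF D F F] .
  have fatou: "(\<integral>\<^sup>+x\<in>D. ennreal ((cmod (F n x - g x))\<^sup>2) \<partial>lborel) \<le> ennreal e"
    if N: "\<And>m n. m \<ge> N \<Longrightarrow> n \<ge> N \<Longrightarrow> square_norm D (\<lambda>x. F m x - F n x) < e" and n: "n \<ge> N" for N n e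
  proof -
    have "(\<integral>\<^sup>+x\<in>D. ennreal ((cmod (F n x - g x))\<^sup>2) \<partial>lborel) =
        (\<integral>\<^sup>+x. liminf (\<lambda>m. ennreal ((cmod (F n x - F m x))\<^sup>2) * indicator D x) \<partial>lborel)"
    proof (intro nn_integral_cong)
      fix x
      show "ennreal ((cmod (F n x - g x))\<^sup>2) * indicator D x =
          liminf (\<lambda>m. ennreal ((cmod (F n x - F m x))\<^sup>2) * indicator D x)"
      proof (cases "x \<in> D")
        case True
        have "(\<lambda>m. ennreal ((cmod (F n x - F m x))\<^sup>2)) \<longlonglongrightarrow> ennreal ((cmod (F n x - g x))\<^sup>2)"
          by (intro tendsto_intros lim True)
        from lim_imp_Liminf[OF sequentially_bot this] show ?thesis using True by simp
      qed (simp add: Liminf_const)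
    qed
    also have "\<dots> \<le> liminf (\<lambda>m. \<integral>\<^sup>+x. ennreal ((cmod (F n x - F m x))\<^sup>2) * indicator D x \<partial>lborel)"
    proof (rule nn_integral_liminf)
      fix m
      have "(\<lambda>x. indicator D x *\<^sub>R (cmod (F n x - F m x))\<^sup>2) \<in> borel_measurable borel"
        by (intro borel_measurable_continuous_on_indicator continuous_intros
            holomorphic_several_imp_continuous_on[OF bergman_space_holomorphic[OF F]] borel_open D)
      then have "(\<lambda>x. ennreal (indicator D x *\<^sub>R (cmod (F n x - F m x))\<^sup>2)) \<in> borel_measurable lborel"
        by simp
      then show "(\<lambda>x. ennreal ((cmod (F n x - F m x))\<^sup>2) * indicator D x) \<in> borel_measurable lborel"
        by (simp add: ennreal_mult' mult.commute ennreal_indicator)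
    qed
    also have "\<dots> \<le> ennreal e"
    proof (rule Liminf_le)
      show "\<forall>\<^sub>F m in sequentially. (\<integral>\<^sup>+x. ennreal ((cmod (F n x - F m x))\<^sup>2) * indicator D x \<partial>lborel) \<le> ennreal e"
        using N[OF n] less_imp_le
        by (fastforce simp: eventually_sequentially nn_integral_eq_square_norm[OF diff] intro!: exI[of _ N] ennreal_leI)
    qed simp
    finally show ?thesis .
  qed
  have diffg: "(\<lambda>x. F n x - g x) \<in> bergman_space D" if "n \<ge> N"
    and N: "\<And>m n. m \<ge> N \<Longrightarrow> n \<ge> N \<Longrightarrow> square_norm D (\<lambda>x. F m x - F n x) < e" for n N e
    using fatou[OF N that(1)] holomorphic_several_diff[OF bergman_space_holomorphic[OF F] hol D]
    by (auto simp: bergman_space_iff[OF D] intro: le_less_trans)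
  obtain N where N: "\<And>m n. m \<ge> N \<Longrightarrow> n \<ge> N \<Longrightarrow> square_norm D (\<lambda>x. F m x - F n x) < 1"
    using cau[of 1] by auto
  show ?thesis
  proof (rule that)
    show "g \<in> bergman_space D"
      using bergman_space_diff[OF D F[of N] diffg[of N N 1, OF order_refl N]] by simp
    show "(\<lambda>n. square_norm D (\<lambda>x. F n x - g x)) \<longlonglongrightarrow> 0"
    proof (rule LIMSEQ_I)
      fix e :: real assume e: "e > 0"
      then obtain M where M: "\<And>m n. m \<ge> M \<Longrightarrow> n \<ge> M \<Longrightarrow> square_norm D (\<lambda>x. F m x - F n x) < e / 2"
        using cau[of "e/2"] by auto
      have "norm (square_norm D (\<lambda>x. F n x - g x) - 0) < e" if n: "n \<ge> M" for n
        using fatou[OF M n] e nn_integral_eq_square_norm[OF diffg[OF n M]] square_norm_nonneg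
        by (simp add: square_norm_nonneg)
      then show "\<exists>no. \<forall>n\<ge>no. norm (square_norm D (\<lambda>x. F n x - g x) - 0) < e" by blast
    qed
  qed
qed

lemma bergman_space_semi_hilbert:
  fixes D :: "(complex^'N) set"
  assumes D: "open D"
  shows "semi_hilbert (\<lambda>c f x. c * f x) (bergman_space D) (L2_inner D)"
proof -
  interpret V: vector_space "\<lambda>c (f :: complex^'N \<Rightarrow> complex) x. c * f x"
    by unfold_locales (auto simp: fun_eq_iff algebra_simps)
  show ?thesis
  proof
    show "V.subspace (bergman_space D)"
      using bergman_space_subspace[OF D] by (auto simp: V.subspace_def zero_fun_def plus_fun_def)
    fix f g h :: "complex^'N \<Rightarrow> complex" and c
    show "L2_inner D (f + g) h = L2_inner D f h + L2_inner D g h"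
      if "f \<in> bergman_space D" "g \<in> bergman_space D" "h \<in> bergman_space D"
      using set_integral_add(2)[OF L2_inner_integrable[OF D that(1,3)] L2_inner_integrable[OF D that(2,3)]]
      by (simp add: L2_inner_def algebra_simps)
    show "L2_inner D (\<lambda>x. c * f x) h = c * L2_inner D f h"
      by (simp add: L2_inner_def mult.assoc)
    show "L2_inner D g f = cnj (L2_inner D f g)"
    proof -
      have "(\<lambda>x. indicator D x *\<^sub>R (g x * cnj (f x))) = (\<lambda>x. cnj (indicator D x *\<^sub>R (f x * cnj (g x))))"
        by (simp add: fun_eq_iff mult.commute)
      then show ?thesis
        unfolding L2_inner_def set_lebesgue_integral_def by (simp only: Bochner_Integration.integral_cnj)
    qed
    show "0 \<le> Re (L2_inner D f f)" by (simp add: L2_inner_self square_norm_nonneg)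
  next
    fix F :: "nat \<Rightarrow> complex^'N \<Rightarrow> complex"
    assume F: "\<And>n. F n \<in> bergman_space D"
      and cau: "\<And>e. e > 0 \<Longrightarrow> \<exists>N. \<forall>m\<ge>N. \<forall>n\<ge>N. Re (L2_inner D (F m - F n) (F m - F n)) < e"
    show "\<exists>g\<in>bergman_space D. (\<lambda>n. Re (L2_inner D (F n - g) (F n - g))) \<longlonglongrightarrow> 0"
      using cau unfolding L2_inner_self Re_complex_of_real fun_diff_def
    proof -
      assume "\<And>e. e > 0 \<Longrightarrow> \<exists>N. \<forall>m\<ge>N. \<forall>n\<ge>N. square_norm D (\<lambda>x. F m x - F n x) < e"
      from bergman_space_complete[OF D F this]
      show "\<exists>g\<in>bergman_space D. (\<lambda>n. square_norm D (\<lambda>x. F n x - g x)) \<longlonglongrightarrow> 0" by blast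
    qed
  qed
qed

section \<open>The Bergman kernel as a reproducing kernel\<close>

definition reproduces :: "(complex^'N) set \<Rightarrow> complex^'N \<Rightarrow> (complex^'N \<Rightarrow> complex) \<Rightarrow> bool"
  where "reproduces D w k \<longleftrightarrow> k \<in> bergman_space D \<and> (\<forall>f\<in>bergman_space D. L2_inner D f k = f w)"

lemma exists_reproducing_function:
  assumes D: "open D" and w: "w \<in> D"
  obtains k where "reproduces D w k"
proof -
  interpret H: semi_hilbert "\<lambda>c f x. c * f x" "bergman_space D" "L2_inner D"
    using D by (rule bergman_space_semi_hilbert)
  obtain r C where "r > 0" and bound: "\<And>x f. \<lbrakk>x \<in> ball w r; f \<in> bergman_space D\<rbrakk> \<Longrightarrow> (cmod (f x))\<^sup>2 \<le> C * square_norm D f"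
    using locally_bounded_evaluation[OF D w] by metis
  have bound': "(cmod (f w))\<^sup>2 \<le> C * H.sqn f" if "f \<in> bergman_space D" for f
    using bound[of w f] that \<open>r > 0\<close> by (simp add: H.sqn_def L2_inner_self)
  obtain k where "k \<in> bergman_space D" "\<And>f. f \<in> bergman_space D \<Longrightarrow> L2_inner D f k = f w"
  proof (rule H.Riesz_representation[of "\<lambda>f. f w" C])
    fix k assume "k \<in> bergman_space D" "\<And>f. f \<in> bergman_space D \<Longrightarrow> L2_inner D f k = f w"
    then show thesis by (rule that)
  qed (simp_all add: bound')
  then have "reproduces D w k" by (simp add: reproduces_def)
  then show ?thesis by (rule that)
qed

text \<open>
  If \<open>k\<close> and \<open>k'\<close> reproduce the values at \<open>w\<close> and \<open>z\<close>, then the Fourier coefficients of \<open>k\<close> are the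
  numbers \<open>cnj (\<phi> w)\<close> and Parseval's identity for \<open>k\<close> and \<open>k'\<close> is the series defining the kernel.
  Its sum \<open>k z\<close> does not depend on the basis.  A basis exists, so the definite description is
  determined.
\<close>

theorem bergman_kernel_eqI:
  assumes D: "open D" and w: "w \<in> D" and z: "z \<in> D" and k: "reproduces D w k"
  shows "bergman_kernel D z w = k z"
proof -
  interpret H: semi_hilbert "\<lambda>c f x. c * f x" "bergman_space D" "L2_inner D"
    using D by (rule bergman_space_semi_hilbert)
  have sum_apply: "(\<Sum>\<phi>\<in>F. (\<lambda>x. c \<phi> * \<phi> x)) x = (\<Sum>\<phi>\<in>F. c \<phi> * \<phi> x)"
    for F and c :: "(complex^'N \<Rightarrow> complex) \<Rightarrow> complex" and x :: "complex^'N"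
    by (induction F rule: infinite_finite_induct) auto
  have sqn: "H.sqn (f - (\<Sum>\<phi>\<in>F. (\<lambda>x. c \<phi> * \<phi> x))) =
      (LINT x:D|lborel. (cmod (f x - (\<Sum>\<phi>\<in>F. c \<phi> * \<phi> x)))\<^sup>2)" for f F c
    by (simp add: H.sqn_def L2_inner_self square_norm_def sum_apply)
  have basis: "complete_orthonormal_basis D B \<longleftrightarrow> H.orthonormal B \<and>
      (\<forall>f\<in>bergman_space D. \<forall>e>0. \<exists>F c. finite F \<and> F \<subseteq> B \<and> H.sqn (f - (\<Sum>\<phi>\<in>F. (\<lambda>x. c \<phi> * \<phi> x))) < e)" for B
    by (simp add: complete_orthonormal_basis_def H.orthonormal_def sqn)
  obtain B0 where B0: "complete_orthonormal_basis D B0"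
  proof (rule H.exists_orthonormal_basis)
    fix B
    assume "H.orthonormal B" and "\<And>f e. \<lbrakk>f \<in> bergman_space D; e > 0\<rbrakk> \<Longrightarrow>
      \<exists>F c. finite F \<and> F \<subseteq> B \<and> H.sqn (f - (\<Sum>\<phi>\<in>F. (\<lambda>x. c \<phi> * \<phi> x))) < e"
    then have "complete_orthonormal_basis D B" unfolding basis by blast
    then show thesis by (rule that)
  qed
  obtain k' where k': "reproduces D z k'" using exists_reproducing_function[OF D z] .
  have sum: "((\<lambda>\<phi>. \<phi> z * cnj (\<phi> w)) has_sum k z) B" if B: "complete_orthonormal_basis D B" for B
  proof -
    have "((\<lambda>\<phi>. L2_inner D k \<phi> * L2_inner D \<phi> k') has_sum L2_inner D k k') B"
      using B k k' unfolding basis by (intro H.Parseval) (auto simp: reproduces_def)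
    moreover have "L2_inner D k k' = k z" using k k' by (simp add: reproduces_def)
    moreover have "L2_inner D k \<phi> * L2_inner D \<phi> k' = \<phi> z * cnj (\<phi> w)" if "\<phi> \<in> B" for \<phi>
    proof -
      have \<phi>: "\<phi> \<in> bergman_space D" using that B by (auto simp: complete_orthonormal_basis_def)
      then have "L2_inner D k \<phi> = cnj (\<phi> w)"
        using H.ip_cnj[of \<phi> k] k by (simp add: reproduces_def)
      then show ?thesis using k' \<phi> by (simp add: reproduces_def mult.commute)
    qed
    ultimately show ?thesis by (metis (no_types, lifting) has_sum_cong)
  qed
  show ?thesis
    unfolding bergman_kernel_def
  proof (rule the_equality)
    show "\<forall>B. complete_orthonormal_basis D B \<longrightarrow> ((\<lambda>\<phi>. \<phi> z * cnj (\<phi> w)) has_sum k z) B"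
      using sum by blast
    show "c = k z" if "\<forall>B. complete_orthonormal_basis D B \<longrightarrow> ((\<lambda>\<phi>. \<phi> z * cnj (\<phi> w)) has_sum c) B" for c
      using that B0 sum[OF B0] has_sum_unique by blast
  qed
qed

text \<open>
  An idempotent linear contraction is an orthogonal projection.  For \<open>u = f - f \<circ> E\<close> and \<open>E\<close>-invariant
  \<open>g\<close> every \<open>g - t u\<close> is mapped to \<open>g\<close>, so no such perturbation is shorter than \<open>g\<close>, which forces
  \<open>g\<close> to be orthogonal to \<open>u\<close>.
\<close>

proposition circular_retraction_orthogonal:
  assumes D: "open D" and E: "circular_retraction E D" "complex_linear E"
    and f: "f \<in> bergman_space D" and g: "g \<in> bergman_space D" and gE: "\<And>x. x \<in> D \<Longrightarrow> g (E x) = g x"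
  shows "(\<lambda>x. f (E x)) \<in> bergman_space D" "L2_inner D f g = L2_inner D (\<lambda>x. f (E x)) g"
proof -
  interpret H: semi_hilbert "\<lambda>c f x. c * f x" "bergman_space D" "L2_inner D"
    using D by (rule bergman_space_semi_hilbert)
  have rot0: "rotate_about E 0 x = E x" for x by (simp add: rotate_about_def)
  have EE: "E (E x) = E x" and ED: "x \<in> D \<Longrightarrow> E x \<in> D" for x
    using E(1) unfolding circular_retraction_def by (metis rot0, metis rot0 norm_zero zero_le_one)
  have le: "(\<integral>\<^sup>+x\<in>D. ennreal ((cmod (h (E x)))\<^sup>2) \<partial>lborel) \<le> ennreal (square_norm D h)"
    if "h \<in> bergman_space D" for h
    using circular_retraction_nn_integral_le[OF bergman_space_holomorphic[OF that] D E(1)]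
    by (simp add: nn_integral_eq_square_norm[OF that])
  have comp: "(\<lambda>x. h (E x)) \<in> bergman_space D" if "h \<in> bergman_space D" for h
    using le[OF that] holomorphic_several_compose_linear[OF bergman_space_holomorphic[OF that] D E(2)] ED
    by (auto simp: bergman_space_iff[OF D] intro: le_less_trans)
  then show fE: "(\<lambda>x. f (E x)) \<in> bergman_space D" using f .
  define u where "u = f - (\<lambda>x. f (E x))"
  have u: "u \<in> bergman_space D" using f fE by (simp add: u_def)
  have "(cmod (L2_inner D g u))\<^sup>2 \<le> 0 * H.sqn u"
  proof (rule H.almost_minimal_imp_almost_orthogonal[OF g u])
    fix t
    define h where "h = g - (\<lambda>x. t * u x)"
    have h: "h \<in> bergman_space D" using g u unfolding h_def by (intro H.H_closed)
    have "ennreal (square_norm D g) = (\<integral>\<^sup>+x\<in>D. ennreal ((cmod (h (E x)))\<^sup>2) \<partial>lborel)"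
      unfolding nn_integral_eq_square_norm[OF g, symmetric]
      by (intro nn_integral_cong) (auto simp: indicator_def h_def u_def EE gE)
    also have "\<dots> \<le> ennreal (square_norm D h)" by (rule le[OF h])
    finally show "H.sqn g - 0 \<le> H.sqn (g - (\<lambda>x. t * u x))"
      by (simp add: H.sqn_def L2_inner_self square_norm_nonneg h_def)
  qed
  then have "L2_inner D u g = 0" using H.ip_cnj[OF g u] by simp
  then show "L2_inner D f g = L2_inner D (\<lambda>x. f (E x)) g"
    unfolding u_def using H.ip_diff_left[OF f fE g] by simp
qed

section \<open>Integration over the fibres\<close>

text \<open>
  Tonelli's theorem in the coordinates given by the isometry \<open>J\<close>; the integrand depends on the base
  variable only, so each fibre contributes its volume.
\<close>

lemma nn_integral_fibres:
  fixes J :: "'a::euclidean_space \<times> 'b::euclidean_space \<Rightarrow> 'c::euclidean_space"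
  assumes iso: "\<And>u v. dist (J u) (J v) = dist u v" "surj J" "DIM('c) = DIM('a) + DIM('b)"
    and pJ: "\<And>z w. p (J (z, w)) = w" and p [measurable]: "p \<in> borel_measurable borel"
    and D [measurable]: "D \<in> sets borel" and h [measurable]: "h \<in> borel_measurable borel"
  shows "(\<integral>\<^sup>+x\<in>D. h (p x) \<partial>lborel) = (\<integral>\<^sup>+w. h w * emeasure lborel {z. J (z, w) \<in> D} \<partial>lborel)"
proof -
  have distr: "distr lborel borel J = lborel"
    using iso by (intro lborel_distr_isometry) simp_all
  have [measurable]: "J \<in> borel_measurable borel"
    by (rule borel_measurable_continuous_onI) (use iso(1) in \<open>auto simp: continuous_on_iff\<close>)
  have [measurable]: "J \<in> borel_measurable (lborel \<Otimes>\<^sub>M lborel)"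
    by (simp add: lborel_prod)
  have "(\<integral>\<^sup>+x\<in>D. h (p x) \<partial>lborel) = (\<integral>\<^sup>+x. h (p x) * indicator D x \<partial>distr lborel borel J)"
    by (simp add: distr)
  also have "\<dots> = (\<integral>\<^sup>+u. h (p (J u)) * indicator D (J u) \<partial>lborel)"
    by (rule nn_integral_distr) measurable
  also have "\<dots> = (\<integral>\<^sup>+u. h (p (J u)) * indicator D (J u) \<partial>(lborel \<Otimes>\<^sub>M lborel))"
    by (simp add: lborel_prod)
  also have "\<dots> = (\<integral>\<^sup>+w. (\<integral>\<^sup>+z. h (p (J (z, w))) * indicator D (J (z, w)) \<partial>lborel) \<partial>lborel)"
    by (rule lborel_pair.nn_integral_snd[symmetric]) measurable
  also have "\<dots> = (\<integral>\<^sup>+w. h w * emeasure lborel {z. J (z, w) \<in> D} \<partial>lborel)"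
  proof (intro nn_integral_cong)
    fix w
    have "{z. J (z, w) \<in> D} \<in> sets borel"
      using measurable_sets[of "\<lambda>z. J (z, w)" borel borel D] by (simp add: vimage_def)
    then show "(\<integral>\<^sup>+z. h (p (J (z, w))) * indicator D (J (z, w)) \<partial>lborel) = h w * emeasure lborel {z. J (z, w) \<in> D}"
      using nn_integral_cmult_indicator[of "{z. J (z, w) \<in> D}" lborel "h w"]
      by (simp add: pJ indicator_def)
  qed
  finally show ?thesis .
qed

lemma emeasure_complex_ball_square:
  "emeasure lborel {z :: complex^'n. (\<Sum>i\<in>UNIV. (cmod (z $ i))\<^sup>2) < \<rho>} =
    ennreal (pi ^ CARD('n) / fact (CARD('n)) * max 0 \<rho> ^ CARD('n))"
proof -
  have norm: "(\<Sum>i\<in>UNIV. (cmod (z $ i))\<^sup>2) = (norm z)\<^sup>2" for z :: "complex^'n"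
    by (simp add: norm_vec_def L2_set_def sum_nonneg)
  show ?thesis
  proof (cases "\<rho> > 0")
    case True
    have "(norm z)\<^sup>2 < \<rho> \<longleftrightarrow> norm z < sqrt \<rho>" for z :: "complex^'n"
      using real_sqrt_less_iff[of "(norm z)\<^sup>2" \<rho>] by simp
    then have "{z :: complex^'n. (\<Sum>i\<in>UNIV. (cmod (z $ i))\<^sup>2) < \<rho>} = ball 0 (sqrt \<rho>)"
      by (simp only: norm ball_def dist_0_norm)
    moreover have "sqrt \<rho> ^ (CARD('n) * 2) = \<rho> ^ CARD('n)"
      using True by (simp add: power_mult mult.commute[of "CARD('n)"])
    ultimately show ?thesis
      using True unit_ball_vol_even[of "CARD('n)"] by (simp add: emeasure_ball mult.commute)
  next
    case False
    then have "{z :: complex^'n. (\<Sum>i\<in>UNIV. (cmod (z $ i))\<^sup>2) < \<rho>} = {}"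
      by (auto simp: norm not_less intro: order_trans)
    then show ?thesis using False by (simp add: max_def)
  qed
qed

lemma emeasure_disc_powr:
  assumes n: "n > 0"
  shows "emeasure lborel {z :: complex. cmod z powr (2 / real n) < \<rho>} = ennreal (pi * max 0 \<rho> ^ n)"
proof (cases "\<rho> > 0")
  case True
  have "cmod z powr (2 / real n) < \<rho> \<longleftrightarrow> cmod z < \<rho> powr (real n / 2)" for z
  proof -
    define X where "X = cmod z powr (2 / real n)"
    have X: "X \<ge> 0" "X powr (real n / 2) = cmod z" using n by (simp_all add: X_def powr_powr)
    have "X < \<rho> \<Longrightarrow> X powr (real n / 2) < \<rho> powr (real n / 2)"
      using n X(1) by (intro powr_less_mono2) simp_all
    moreover have "\<rho> \<le> X \<Longrightarrow> \<rho> powr (real n / 2) \<le> X powr (real n / 2)"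
      using n True by (intro powr_mono2) simp_all
    ultimately show ?thesis unfolding X(2) X_def[symmetric] by linarith
  qed
  then have "{z :: complex. cmod z powr (2 / real n) < \<rho>} = ball 0 (\<rho> powr (real n / 2))"
    by (simp only: ball_def dist_0_norm)
  moreover have "(\<rho> powr (real n / 2))\<^sup>2 = \<rho> ^ n"
    using True by (simp add: powr_realpow[symmetric] powr_powr[symmetric] powr_powr flip: powr_add)
  ultimately show ?thesis
    using True by (simp add: emeasure_ball unit_ball_vol_numeral)
next
  case False
  then have "{z :: complex. cmod z powr (2 / real n) < \<rho>} = {}"
    by (auto simp: not_less intro: order_trans)
  then show ?thesis using False n by (simp add: max_def)
qed

section \<open>The two domains\<close>

lemma join_point_nth [simp]:
  "join_point z w1 w2 $ Inl i = z $ i" "join_point z w1 w2 $ Inr 1 = w1" "join_point z w1 w2 $ Inr 2 = w2"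
  by (simp_all add: join_point_def)

lemma vec_join_eq_iff:
  "x = y \<longleftrightarrow> (\<forall>i. x $ Inl i = y $ Inl i) \<and> x $ Inr (1::2) = y $ Inr 1 \<and> x $ Inr 2 = y $ Inr 2"
  by (simp add: vec_eq_iff split_sum_all forall_2)

lemma sum_join_index: "(\<Sum>k\<in>UNIV. f k) = (\<Sum>i\<in>UNIV. f (Inl i)) + f (Inr 1) + f (Inr (2::2))"
  for f :: "'n::finite + 2 \<Rightarrow> real"
proof -
  have "(\<Sum>k\<in>UNIV. f k) = (\<Sum>i\<in>UNIV. f (Inl i)) + (\<Sum>j\<in>UNIV. f (Inr j))"
    unfolding UNIV_Plus_UNIV[symmetric] by (subst sum.Plus) simp_all
  then show ?thesis by (simp add: sum_2)
qed

lemma norm_join_coordinates: "norm (x :: complex^('n::finite + 2)) =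
    sqrt ((\<Sum>i\<in>UNIV. (cmod (x $ Inl i))\<^sup>2) + (cmod (x $ Inr 1))\<^sup>2 + (cmod (x $ Inr 2))\<^sup>2)"
  by (simp add: norm_vec_def L2_set_def sum_join_index)

lemma norm_coordinates_3: "norm (y :: complex^3) =
    sqrt ((cmod (y $ 1))\<^sup>2 + (cmod (y $ 2))\<^sup>2 + (cmod (y $ 3))\<^sup>2)"
  by (simp add: norm_vec_def L2_set_def sum_3)

lemma mem_D_dom_iff: "x \<in> D_dom q r \<longleftrightarrow>
    (\<Sum>i\<in>UNIV. (cmod (x $ Inl i))\<^sup>2) + cmod (x $ Inr 1) powr q < 1 \<and>
    (\<Sum>i\<in>UNIV. (cmod (x $ Inl i))\<^sup>2) + cmod (x $ Inr 2) powr r < 1"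
  (is "_ \<longleftrightarrow> ?R")
proof
  assume ?R
  moreover have "x = join_point (\<chi> i. x $ Inl i) (x $ Inr 1) (x $ Inr 2)"
    by (simp add: vec_join_eq_iff)
  ultimately show "x \<in> D_dom q r"
    unfolding D_dom_def by (intro CollectI exI[of _ "\<chi> i. x $ Inl i"] exI[of _ "x $ Inr 1"] exI[of _ "x $ Inr 2"]) simp
qed (auto simp: D_dom_def)

lemma mem_D_inv_dom_iff: "y \<in> D_inv_dom n q r \<longleftrightarrow>
    cmod (y $ 1) powr (2 / real n) + cmod (y $ 2) powr q < 1 \<and>
    cmod (y $ 1) powr (2 / real n) + cmod (y $ 3) powr r < 1"
  (is "_ \<longleftrightarrow> ?R")
proof
  assume ?R
  moreover have "y = vector [y $ 1, y $ 2, y $ 3]" by (simp add: vec_eq_iff forall_3)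
  ultimately show "y \<in> D_inv_dom n q r"
    unfolding D_inv_dom_def by (intro CollectI exI[of _ "y $ 1"] exI[of _ "y $ 2"] exI[of _ "y $ 3"]) simp
qed (auto simp: D_inv_dom_def)

lemma continuous_on_norm_powr:
  fixes f :: "'a::topological_space \<Rightarrow> complex"
  assumes "continuous_on S f" "a > 0"
  shows "continuous_on S (\<lambda>x. cmod (f x) powr a)"
  using assms by (intro continuous_on_powr' continuous_intros) auto

lemma open_D_dom:
  assumes "q > 0" "r > 0"
  shows "open (D_dom q r :: (complex^('n::finite + 2)) set)"
proof -
  have "open {x :: complex^('n + 2). (\<Sum>i\<in>UNIV. (cmod (x $ Inl i))\<^sup>2) + cmod (x $ Inr 1) powr q < 1 \<and>
      (\<Sum>i\<in>UNIV. (cmod (x $ Inl i))\<^sup>2) + cmod (x $ Inr 2) powr r < 1}"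
    using assms
    by (intro open_Collect_conj open_Collect_less continuous_intros continuous_on_norm_powr)
  then show ?thesis by (simp only: mem_D_dom_iff[symmetric] Collect_mem_eq)
qed

lemma open_D_inv_dom:
  assumes "n > 0" "q > 0" "r > 0"
  shows "open (D_inv_dom n q r)"
proof -
  have "open {y :: complex^3. cmod (y $ 1) powr (2 / real n) + cmod (y $ 2) powr q < 1 \<and>
      cmod (y $ 1) powr (2 / real n) + cmod (y $ 3) powr r < 1}"
    using assms
    by (intro open_Collect_conj open_Collect_less continuous_intros continuous_on_norm_powr) simp_all
  then show ?thesis by (simp only: mem_D_inv_dom_iff[symmetric] Collect_mem_eq)
qed

text \<open>
  The coordinates \<open>(w\<^sub>1, w\<^sub>2)\<close> are the base of both domains; \<open>centre_D\<close> and \<open>centre_inv\<close> embed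
  the base as the slice on which the remaining coordinates vanish.
\<close>

definition base_D :: "complex^('n::finite + 2) \<Rightarrow> complex \<times> complex"
  where "base_D x = (x $ Inr 1, x $ Inr 2)"

definition base_inv :: "complex^3 \<Rightarrow> complex \<times> complex"
  where "base_inv y = (y $ 2, y $ 3)"

definition centre_D :: "complex \<times> complex \<Rightarrow> complex^('n::finite + 2)"
  where "centre_D w = join_point 0 (fst w) (snd w)"

definition centre_inv :: "complex \<times> complex \<Rightarrow> complex^3"
  where "centre_inv w = vector [0, fst w, snd w]"

text \<open>
  For positive exponents this is the unit bidisc; keeping the powers makes it literally the base of
  the two domains for all exponents.
\<close>

definition bidisc :: "real \<Rightarrow> real \<Rightarrow> (complex \<times> complex) set"
  where "bidisc q r = {w. cmod (fst w) powr q < 1 \<and> cmod (snd w) powr r < 1}"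

lemma base_centre [simp]: "base_D (centre_D w) = w" "base_inv (centre_inv w) = w"
  by (simp_all add: base_D_def centre_D_def base_inv_def centre_inv_def)

lemma centre_mem_iff [simp]:
  "centre_D w \<in> D_dom q r \<longleftrightarrow> w \<in> bidisc q r" "centre_inv w \<in> D_inv_dom n q r \<longleftrightarrow> w \<in> bidisc q r"
  by (simp_all add: mem_D_dom_iff mem_D_inv_dom_iff bidisc_def centre_D_def centre_inv_def)

lemma base_mem_bidisc:
  "x \<in> D_dom q r \<Longrightarrow> base_D x \<in> bidisc q r" "y \<in> D_inv_dom n q r \<Longrightarrow> base_inv y \<in> bidisc q r"
proof -
  have "0 \<le> (\<Sum>i\<in>UNIV. (cmod (x $ Inl i))\<^sup>2)" by (simp add: sum_nonneg)
  then show "x \<in> D_dom q r \<Longrightarrow> base_D x \<in> bidisc q r"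
    by (simp add: mem_D_dom_iff bidisc_def base_D_def)
  have "0 \<le> cmod (y $ 1) powr (2 / real n)" by simp
  then show "y \<in> D_inv_dom n q r \<Longrightarrow> base_inv y \<in> bidisc q r"
    unfolding mem_D_inv_dom_iff bidisc_def base_inv_def mem_Collect_eq fst_conv snd_conv by linarith
qed

lemma open_bidisc: "q > 0 \<Longrightarrow> r > 0 \<Longrightarrow> open (bidisc q r)"
  unfolding bidisc_def
  by (intro open_Collect_conj open_Collect_less continuous_intros continuous_on_norm_powr)

lemma continuous_base: "continuous_on S base_D" "continuous_on T base_inv"
  unfolding base_D_def base_inv_def by (intro continuous_intros)+

lemma continuous_centre:
  "continuous_on S (centre_D :: _ \<Rightarrow> complex^('n::finite + 2))" "continuous_on S centre_inv"
proof -
  have "dist (centre_D u :: complex^('n + 2)) (centre_D v) = dist u v" "dist (centre_inv u) (centre_inv v) = dist u v" for u v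
    by (simp_all add: dist_norm norm_join_coordinates norm_coordinates_3 norm_Pair centre_D_def centre_inv_def
        norm_prod_def)
  then show "continuous_on S (centre_D :: _ \<Rightarrow> complex^('n + 2))" "continuous_on S centre_inv"
    unfolding continuous_on_iff by metis+
qed

lemma complex_linear_centre_base:
  "complex_linear (\<lambda>x. centre_D (base_D x) :: complex^('m::finite + 2))"
  "complex_linear (\<lambda>y. centre_D (base_inv y) :: complex^('m::finite + 2))"
  "complex_linear (\<lambda>x. centre_inv (base_D x))"
  "complex_linear (\<lambda>y. centre_inv (base_inv y))"
  unfolding complex_linear_def
  by (auto intro!: linearI simp: vec_join_eq_iff vec_eq_iff[where 'b=3] forall_3
      centre_D_def centre_inv_def base_D_def base_inv_def)

lemma circular_retraction_D_dom:
  "circular_retraction (\<lambda>x. centre_D (base_D x)) (D_dom q r :: (complex^('n::finite + 2)) set)"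
proof -
  let ?E = "\<lambda>x :: complex^('n + 2). centre_D (base_D x) :: complex^('n + 2)"
  have rot [simp]: "rotate_about ?E \<zeta> x $ Inl i = \<zeta> * x $ Inl i" "rotate_about ?E \<zeta> x $ Inr 1 = x $ Inr 1"
     "rotate_about ?E \<zeta> x $ Inr 2 = x $ Inr 2" for \<zeta> x i
    by (simp_all add: rotate_about_def centre_D_def base_D_def)
  have "base_D (rotate_about ?E \<zeta> x) = base_D x" for \<zeta> x by (simp add: base_D_def[of "rotate_about _ _ _"] base_D_def[of x])
  moreover have "dist (rotate_about ?E \<zeta> x) (rotate_about ?E \<zeta> y) = dist x y" if "cmod \<zeta> = 1" for \<zeta> x y
    using that by (simp add: dist_norm norm_join_coordinates norm_mult flip: right_diff_distrib)
  moreover have "rotate_about ?E \<zeta> x \<in> D_dom q r" if "cmod \<zeta> \<le> 1" "x \<in> D_dom q r" for \<zeta> x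
  proof -
    have "(\<Sum>i\<in>UNIV. (cmod (\<zeta> * x $ Inl i))\<^sup>2) \<le> (\<Sum>i\<in>UNIV. (cmod (x $ Inl i))\<^sup>2)"
      using that(1) by (intro sum_mono power_mono) (auto simp: norm_mult mult_left_le_one_le)
    then show ?thesis using that(2) by (auto simp: mem_D_dom_iff)
  qed
  moreover have "continuous_on UNIV ?E"
    by (rule continuous_on_compose2[OF continuous_centre(1)[of UNIV] continuous_base(1)]) simp
  ultimately show ?thesis by (auto simp: circular_retraction_def)
qed

lemma circular_retraction_D_inv_dom: "circular_retraction (\<lambda>y. centre_inv (base_inv y)) (D_inv_dom n q r)"
proof -
  let ?E = "\<lambda>y. centre_inv (base_inv y)"
  have rot [simp]: "rotate_about ?E \<zeta> y $ 1 = \<zeta> * y $ 1" "rotate_about ?E \<zeta> y $ 2 = y $ 2"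
     "rotate_about ?E \<zeta> y $ 3 = y $ 3" for \<zeta> y
    by (simp_all add: rotate_about_def centre_inv_def base_inv_def)
  have "base_inv (rotate_about ?E \<zeta> y) = base_inv y" for \<zeta> y
    by (simp add: base_inv_def[of "rotate_about _ _ _"] base_inv_def[of y])
  moreover have "dist (rotate_about ?E \<zeta> x) (rotate_about ?E \<zeta> y) = dist x y" if "cmod \<zeta> = 1" for \<zeta> x y
    using that by (simp add: dist_norm norm_coordinates_3 norm_mult flip: right_diff_distrib)
  moreover have "rotate_about ?E \<zeta> y \<in> D_inv_dom n q r" if "cmod \<zeta> \<le> 1" "y \<in> D_inv_dom n q r" for \<zeta> y
  proof -
    have "cmod (\<zeta> * y $ 1) powr (2 / real n) \<le> cmod (y $ 1) powr (2 / real n)"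
      using that(1) by (intro powr_mono2) (auto simp: norm_mult mult_left_le_one_le)
    then show ?thesis using that(2) by (auto simp: mem_D_inv_dom_iff)
  qed
  moreover have "continuous_on UNIV ?E"
    by (rule continuous_on_compose2[OF continuous_centre(2)[of UNIV] continuous_base(2)]) simp
  ultimately show ?thesis by (auto simp: circular_retraction_def)
qed

section \<open>Comparison of the two domains\<close>

text \<open>
  A fibre of the first domain is a ball of radius \<open>\<surd>\<rho>\<close> in complex \<open>n\<close>-space, with volume
  \<open>\<pi>\<^sup>n \<rho>\<^sup>n / n!\<close>; the corresponding fibre of the second domain is a disc of radius \<open>\<rho>\<^sup>n\<^sup>/\<^sup>2\<close>, with area
  \<open>\<pi> \<rho>\<^sup>n\<close>.
\<close>

definition volume_ratio :: "nat \<Rightarrow> real"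
  where "volume_ratio n = pi ^ (n - 1) / fact n"

lemma fibre_volumes:
  "emeasure lborel {z :: complex^'n. join_point z (fst w) (snd w) \<in> D_dom q r} =
    ennreal (volume_ratio (CARD('n))) *
      emeasure lborel {z. vector [z, fst w, snd w] \<in> D_inv_dom (CARD('n)) q r}"
proof -
  define \<rho> where "\<rho> = min (1 - cmod (fst w) powr q) (1 - cmod (snd w) powr r)"
  have n: "CARD('n) > 0" by simp
  then have pi: "pi ^ CARD('n) = pi ^ (CARD('n) - 1) * pi"
    by (metis Suc_diff_1 power_Suc2)
  have "{z :: complex^'n. join_point z (fst w) (snd w) \<in> D_dom q r} = {z. (\<Sum>i\<in>UNIV. (cmod (z $ i))\<^sup>2) < \<rho>}"
    "{z. vector [z, fst w, snd w] \<in> D_inv_dom (CARD('n)) q r} = {z. cmod z powr (2 / real (CARD('n))) < \<rho>}"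
    by (auto simp: mem_D_dom_iff mem_D_inv_dom_iff \<rho>_def)
  then show ?thesis
    using emeasure_disc_powr[OF n] 
    by (simp add: emeasure_complex_ball_square volume_ratio_def pi flip: ennreal_mult')
qed

lemma base_measurable [measurable]: "base_D \<in> borel_measurable borel" "base_inv \<in> borel_measurable borel"
  using continuous_base[of UNIV] by (auto intro: borel_measurable_continuous_onI)

lemma nn_integral_base:
  fixes h :: "complex \<times> complex \<Rightarrow> ennreal"
  assumes q: "q > 0" "r > 0" and h [measurable]: "h \<in> borel_measurable borel"
  shows "(\<integral>\<^sup>+x\<in>(D_dom q r :: (complex^('n::finite + 2)) set). h (base_D x) \<partial>lborel) =
    ennreal (volume_ratio (CARD('n))) * (\<integral>\<^sup>+y\<in>D_inv_dom (CARD('n)) q r. h (base_inv y) \<partial>lborel)"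
proof -
  define J where "J u = join_point (fst u) (fst (snd u)) (snd (snd u))" for u :: "(complex^'n) \<times> complex \<times> complex"
  define J' where "J' u = (vector [fst u, fst (snd u), snd (snd u)] :: complex^3)" for u :: "complex \<times> complex \<times> complex"
  have meas: "D_inv_dom (CARD('n)) q r \<in> sets borel" using q by (intro borel_open open_D_inv_dom) auto
  have "(\<integral>\<^sup>+x\<in>(D_dom q r :: (complex^('n + 2)) set). h (base_D x) \<partial>lborel) =
      (\<integral>\<^sup>+w. h w * emeasure lborel {z. J (z, w) \<in> D_dom q r} \<partial>lborel)"
  proof (rule nn_integral_fibres)
    show "dist (J u) (J v) = dist u v" for u v
      by (simp add: J_def dist_norm norm_join_coordinates norm_prod_def norm_vec_def L2_set_def sum_nonneg)
    show "surj J"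
    proof (rule surjI)
      show "J (\<chi> i. x $ Inl i, x $ Inr 1, x $ Inr 2) = x" for x
        by (simp add: J_def vec_join_eq_iff)
    qed
  qed (use q in \<open>auto simp: J_def base_D_def[of "join_point _ _ _"] base_measurable intro!: borel_open open_D_dom\<close>)
  also have "\<dots> = (\<integral>\<^sup>+w. ennreal (volume_ratio (CARD('n))) *
      (h w * emeasure lborel {z. J' (z, w) \<in> D_inv_dom (CARD('n)) q r}) \<partial>lborel)"
    by (simp add: J_def J'_def fibre_volumes mult_ac)
  also have "\<dots> = ennreal (volume_ratio (CARD('n))) *
      (\<integral>\<^sup>+w. h w * emeasure lborel {z. J' (z, w) \<in> D_inv_dom (CARD('n)) q r} \<partial>lborel)"
  proof (rule nn_integral_cmult)
    have "emeasure lborel {z. J' (z, w) \<in> D_inv_dom (CARD('n)) q r} =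
        ennreal (pi * max 0 (min (1 - cmod (fst w) powr q) (1 - cmod (snd w) powr r)) ^ CARD('n))" for w
    proof -
      have "{z. J' (z, w) \<in> D_inv_dom (CARD('n)) q r} =
          {z. cmod z powr (2 / real (CARD('n))) < min (1 - cmod (fst w) powr q) (1 - cmod (snd w) powr r)}"
        by (auto simp: mem_D_inv_dom_iff J'_def)
      moreover have "CARD('n) > 0" by simp
      ultimately show ?thesis by (simp only: emeasure_disc_powr)
    qed
    moreover have "(\<lambda>w. pi * max 0 (min (1 - cmod (fst w) powr q) (1 - cmod (snd w) powr r)) ^ CARD('n))
        \<in> borel_measurable borel"
      by (intro borel_measurable_continuous_onI continuous_intros continuous_on_norm_powr q)
    then have "(\<lambda>w. h w * ennreal (pi * max 0 (min (1 - cmod (fst w) powr q) (1 - cmod (snd w) powr r)) ^ CARD('n)))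
        \<in> borel_measurable borel"
      using h by (intro borel_measurable_times_ennreal measurable_compose[OF _ measurable_ennreal])
    ultimately show "(\<lambda>w. h w * emeasure lborel {z. J' (z, w) \<in> D_inv_dom (CARD('n)) q r}) \<in> borel_measurable lborel"
      by simp
  qed
  also have "(\<integral>\<^sup>+w. h w * emeasure lborel {z. J' (z, w) \<in> D_inv_dom (CARD('n)) q r} \<partial>lborel) =
      (\<integral>\<^sup>+y\<in>D_inv_dom (CARD('n)) q r. h (base_inv y) \<partial>lborel)"
  proof (rule nn_integral_fibres[symmetric])
    show "dist (J' u) (J' v) = dist u v" for u v
      by (simp add: J'_def dist_norm norm_coordinates_3 norm_prod_def)
    show "surj J'"
    proof (rule surjI)
      show "J' (y $ 1, y $ 2, y $ 3) = y" for y
        by (simp add: J'_def vec_eq_iff forall_3)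
    qed
  qed (use meas in \<open>auto simp: J'_def base_inv_def[of "vector _"] base_measurable\<close>)
  finally show ?thesis .
qed

lemma volume_ratio_pos: "volume_ratio n > 0"
  by (simp add: volume_ratio_def)

text \<open>
  The identity \<open>nn_integral_base\<close> for indicator functions says that the images of the two Lebesgue
  measures on the base agree up to the volume ratio.
\<close>

lemma integral_base:
  fixes G :: "complex \<times> complex \<Rightarrow> complex"
  assumes q: "q > 0" "r > 0" and G [measurable]: "G \<in> borel_measurable borel"
  shows "(LINT x:(D_dom q r :: (complex^('n::finite + 2)) set)|lborel. G (base_D x)) =
    of_real (volume_ratio (CARD('n))) * (LINT y:D_inv_dom (CARD('n)) q r|lborel. G (base_inv y))"
proof -
  let ?D = "D_dom q r :: (complex^('n + 2)) set" and ?D' = "D_inv_dom (CARD('n)) q r"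
  let ?c = "volume_ratio (CARD('n))"
  have [measurable]: "?D \<in> sets borel" "?D' \<in> sets borel"
    using q by (auto intro!: borel_open open_D_dom open_D_inv_dom)
  let ?M = "distr (density lborel (\<lambda>x. ennreal (indicator ?D x))) borel base_D"
  let ?M' = "distr (density lborel (\<lambda>y. ennreal (?c * indicator ?D' y))) borel base_inv"
  have "?M = ?M'"
  proof (rule measure_eqI)
    fix S assume "S \<in> sets ?M"
    then have S [measurable]: "S \<in> sets borel" by simp
    have [measurable]: "base_D -` S \<in> sets borel" "base_inv -` S \<in> sets borel"
      using measurable_sets[OF base_measurable(1) S] measurable_sets[OF base_measurable(2) S] by simp_all
    have "emeasure ?M S = (\<integral>\<^sup>+x\<in>?D. indicator S (base_D x) \<partial>lborel)"
      by (subst emeasure_distr, simp, simp, subst emeasure_density)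
        (auto intro!: nn_integral_cong simp: indicator_def)
    also have "\<dots> = ennreal ?c * (\<integral>\<^sup>+y\<in>?D'. indicator S (base_inv y) \<partial>lborel)"
      by (rule nn_integral_base[OF q]) measurable
    also have "\<dots> = (\<integral>\<^sup>+y. ennreal ?c * (indicator S (base_inv y) * indicator ?D' y) \<partial>lborel)"
      by (rule nn_integral_cmult[symmetric]) measurable
    also have "\<dots> = emeasure ?M' S"
      by (subst emeasure_distr, simp, simp, subst emeasure_density)
        (auto intro!: nn_integral_cong simp: indicator_def)
    finally show "emeasure ?M S = emeasure ?M' S" .
  qed simp
  have "(LINT x:?D|lborel. G (base_D x)) = integral\<^sup>L ?M G"
    unfolding set_lebesgue_integral_def
    by (subst integral_distr, simp, simp, subst integral_density) auto
  also have "\<dots> = integral\<^sup>L ?M' G" by (simp only: \<open>?M = ?M'\<close>)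
  also have "\<dots> = (\<integral>y. (?c * indicator ?D' y) *\<^sub>R G (base_inv y) \<partial>lborel)"
    using volume_ratio_pos[of "CARD('n)"]
    by (subst integral_distr, simp, simp, subst integral_density) auto
  also have "\<dots> = (\<integral>y. ?c *\<^sub>R (indicator ?D' y *\<^sub>R G (base_inv y)) \<partial>lborel)" by simp
  also have "\<dots> = of_real ?c * (LINT y:?D'|lborel. G (base_inv y))"
    unfolding set_lebesgue_integral_def by (subst integral_scaleR_right) (simp add: scaleR_conv_of_real)
  finally show ?thesis .
qed


lemma measurable_on_bidisc:
  fixes c :: "complex \<times> complex \<Rightarrow> complex^'N"
  assumes f: "holomorphic_several f D" and c: "continuous_on UNIV c"
    and B: "open B" "\<And>w. w \<in> B \<Longrightarrow> c w \<in> D"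
  shows "(\<lambda>w. indicator B w *\<^sub>R f (c w)) \<in> borel_measurable borel"
proof (rule borel_measurable_continuous_on_indicator)
  show "continuous_on B (\<lambda>w. f (c w))"
    by (rule continuous_on_compose2[OF holomorphic_several_imp_continuous_on[OF f] continuous_on_subset[OF c]])
       (use B(2) in auto)
qed (use B(1) in auto)

text \<open>
  Let \<open>K\<close> be the claimed function.  Since \<open>K\<close> is constant along the fibres, \<open>f\<close> may be replaced by its
  restriction to the central slice, extended constantly along the fibres.  The inner product is then
  an integral over the base and can be moved to the other domain, where the same replacement is undone
  for \<open>k\<close> and the reproducing property of \<open>k\<close> applies.  The volume ratio produced by the move cancels
  the factor in \<open>K\<close>.
\<close>

theorem reproduces_D_dom:
  fixes w :: "complex \<times> complex"
  assumes q: "q > 0" "r > 0" and w: "w \<in> bidisc q r"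
    and k: "reproduces (D_inv_dom (CARD('n::finite)) q r) (centre_inv w) k"
  shows "reproduces (D_dom q r :: (complex^('n + 2)) set) (centre_D w)
    (\<lambda>x. of_real (1 / volume_ratio (CARD('n))) * k (centre_inv (base_D x)))"
proof -
  let ?D = "D_dom q r :: (complex^('n + 2)) set" and ?D' = "D_inv_dom (CARD('n)) q r"
  let ?c = "volume_ratio (CARD('n))" and ?B = "bidisc q r"
  have D: "open ?D" and D': "open ?D'" and B: "open ?B"
    using q by (auto intro: open_D_dom open_D_inv_dom open_bidisc)
  have c: "?c > 0" by (rule volume_ratio_pos)
  have kD': "k \<in> bergman_space ?D'" using k by (simp add: reproduces_def)
  have retract: "(\<integral>\<^sup>+y\<in>?D'. ennreal ((cmod (k (centre_inv (base_inv y))))\<^sup>2) \<partial>lborel) < \<infinity>"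
    using circular_retraction_nn_integral_le[OF bergman_space_holomorphic[OF kD'] D' circular_retraction_D_inv_dom]
      nn_integral_eq_square_norm[OF kD'] by (auto intro: le_less_trans)
  have meas_sq: "(\<lambda>w. ennreal ((cmod (u w))\<^sup>2)) \<in> borel_measurable borel"
    if [measurable]: "u \<in> borel_measurable borel" for u :: "complex \<times> complex \<Rightarrow> complex"
    by measurable
  have meas_prod: "(\<lambda>w. u w * cnj (v w)) \<in> borel_measurable borel"
    if "u \<in> borel_measurable borel" "v \<in> borel_measurable borel" for u v :: "complex \<times> complex \<Rightarrow> complex"
    using that(1) measurable_compose[OF that(2) borel_measurable_continuous_onI[OF continuous_on_cnj[OF continuous_on_id]]]
    by (rule borel_measurable_times)
  have meas_k: "(\<lambda>w. indicator ?B w *\<^sub>R k (centre_inv w)) \<in> borel_measurable borel"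
    using bergman_space_holomorphic[OF kD'] continuous_centre(2) B
    by (rule measurable_on_bidisc) simp
  have pull: "(\<lambda>x. k (centre_inv (base_D x))) \<in> bergman_space ?D"
  proof -
    let ?h = "\<lambda>w. ennreal ((cmod (indicator ?B w *\<^sub>R k (centre_inv w)))\<^sup>2)"
    have "(\<integral>\<^sup>+x\<in>?D. ennreal ((cmod (k (centre_inv (base_D x))))\<^sup>2) \<partial>lborel) =
        (\<integral>\<^sup>+x\<in>?D. ?h (base_D x) \<partial>lborel)"
      by (intro nn_integral_cong) (auto simp: indicator_def base_mem_bidisc)
    also have "\<dots> = ennreal ?c * (\<integral>\<^sup>+y\<in>?D'. ?h (base_inv y) \<partial>lborel)"
      by (intro nn_integral_base q meas_sq meas_k)
    also have "(\<integral>\<^sup>+y\<in>?D'. ?h (base_inv y) \<partial>lborel) =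
        (\<integral>\<^sup>+y\<in>?D'. ennreal ((cmod (k (centre_inv (base_inv y))))\<^sup>2) \<partial>lborel)"
      by (intro nn_integral_cong) (auto simp: indicator_def base_mem_bidisc)
    finally have "(\<integral>\<^sup>+x\<in>?D. ennreal ((cmod (k (centre_inv (base_D x))))\<^sup>2) \<partial>lborel) < \<infinity>"
      using retract by (simp add: ennreal_mult_less_top)
    moreover have "holomorphic_several (\<lambda>x. k (centre_inv (base_D x))) ?D"
      by (rule holomorphic_several_compose_linear[OF bergman_space_holomorphic[OF kD'] D' complex_linear_centre_base(3)])
         (auto simp: base_mem_bidisc)
    ultimately show ?thesis by (simp add: bergman_space_iff[OF D])
  qed
  define K where "K x = of_real (1 / ?c) * k (centre_inv (base_D x))" for x :: "complex^('n + 2)"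
  have K: "K \<in> bergman_space ?D"
    unfolding K_def[abs_def] by (rule bergman_space_subspace(2)[OF D pull])
  have "L2_inner ?D f K = f (centre_D w)" if f: "f \<in> bergman_space ?D" for f
  proof -
    have meas_f: "(\<lambda>w. indicator ?B w *\<^sub>R f (centre_D w)) \<in> borel_measurable borel"
      using bergman_space_holomorphic[OF f] continuous_centre(1) B
      by (rule measurable_on_bidisc) simp
    define F where "F y = f (centre_D (base_inv y))" for y
    note proj = circular_retraction_orthogonal[OF D circular_retraction_D_dom complex_linear_centre_base(1) f]
    \<comment> \<open>The projection lemma asks for some function that is constant along the fibres; \<open>0\<close> is one.\<close>
    have "(\<lambda>x. 0) \<in> bergman_space ?D" by (rule bergman_space_subspace(1)[OF D])
    then have fE: "(\<lambda>x. f (centre_D (base_D x))) \<in> bergman_space ?D" by (rule proj(1)) simp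
    have F: "F \<in> bergman_space ?D'"
    proof -
      let ?h = "\<lambda>w. ennreal ((cmod (indicator ?B w *\<^sub>R f (centre_D w)))\<^sup>2)"
      have "ennreal ?c * (\<integral>\<^sup>+y\<in>?D'. ennreal ((cmod (F y))\<^sup>2) \<partial>lborel) =
          ennreal ?c * (\<integral>\<^sup>+y\<in>?D'. ?h (base_inv y) \<partial>lborel)"
        unfolding F_def
        by (intro arg_cong[where f="\<lambda>I. ennreal ?c * I"] nn_integral_cong) (auto simp: indicator_def base_mem_bidisc)
      also have "\<dots> = (\<integral>\<^sup>+x\<in>?D. ?h (base_D x) \<partial>lborel)"
        by (intro nn_integral_base[symmetric] q meas_sq meas_f)
      also have "\<dots> = (\<integral>\<^sup>+x\<in>?D. ennreal ((cmod (f (centre_D (base_D x))))\<^sup>2) \<partial>lborel)"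
        by (intro nn_integral_cong) (auto simp: indicator_def base_mem_bidisc)
      also have "\<dots> < \<infinity>" using fE by (simp add: bergman_space_iff[OF D])
      finally have "(\<integral>\<^sup>+y\<in>?D'. ennreal ((cmod (F y))\<^sup>2) \<partial>lborel) < \<infinity>"
        using c by (auto simp: ennreal_mult_less_top)
      moreover have "holomorphic_several F ?D'" unfolding F_def
        by (rule holomorphic_several_compose_linear[OF bergman_space_holomorphic[OF f] D complex_linear_centre_base(2)])
           (auto simp: base_mem_bidisc)
      ultimately show ?thesis by (simp add: bergman_space_iff[OF D'])
    qed
    interpret H': semi_hilbert "\<lambda>c f x. c * f x" "bergman_space ?D'" "L2_inner ?D'"
      using D' by (rule bergman_space_semi_hilbert)
    note proj' = circular_retraction_orthogonal[OF D' circular_retraction_D_inv_dom complex_linear_centre_base(4) kD' F]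
    have kE: "(\<lambda>y. k (centre_inv (base_inv y))) \<in> bergman_space ?D'"
      by (rule proj'(1)) (simp add: F_def)
    let ?G = "\<lambda>w. (indicator ?B w *\<^sub>R f (centre_D w)) * cnj (indicator ?B w *\<^sub>R k (centre_inv w))"
    have "L2_inner ?D f K = L2_inner ?D (\<lambda>x. f (centre_D (base_D x))) K"
      by (rule proj(2)[OF K]) (simp add: K_def)
    also have "\<dots> = (LINT x:?D|lborel. of_real (1 / ?c) * ?G (base_D x))"
      unfolding L2_inner_def K_def set_lebesgue_integral_def
      by (intro Bochner_Integration.integral_cong) (auto simp: indicator_def base_mem_bidisc)
    also have "\<dots> = of_real (1 / ?c) * (of_real ?c * (LINT y:?D'|lborel. ?G (base_inv y)))"
      by (subst set_integral_mult_right, subst integral_base[OF q meas_prod[OF meas_f meas_k]]) (rule refl)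
    also have "\<dots> = (LINT y:?D'|lborel. ?G (base_inv y))" using c by simp
    also have "\<dots> = L2_inner ?D' F (\<lambda>y. k (centre_inv (base_inv y)))"
      unfolding L2_inner_def F_def set_lebesgue_integral_def
      by (intro Bochner_Integration.integral_cong) (auto simp: indicator_def base_mem_bidisc)
    also have "\<dots> = L2_inner ?D' F k"
    proof -
      have "L2_inner ?D' k F = L2_inner ?D' (\<lambda>y. k (centre_inv (base_inv y))) F"
        by (rule proj'(2)) (simp add: F_def)
      then show ?thesis using H'.ip_cnj[OF kD' F] H'.ip_cnj[OF kE F] by simp
    qed
    also have "\<dots> = f (centre_D w)" using k F by (simp add: reproduces_def F_def)
    finally show ?thesis .
  qed
  then show ?thesis using K unfolding reproduces_def K_def[abs_def] by blast
qed

theorem proposition2p3: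
  fixes n :: nat and q r :: real and w1 w2 \<xi>1 \<xi>2 :: complex
  assumes "n = CARD('n::finite)"
    and "q > 0" and "r > 0"
    and "cmod w1 < 1" and "cmod w2 < 1" and "cmod \<xi>1 < 1" and "cmod \<xi>2 < 1"
  shows "complex_of_real (fact n / pi ^ (n - 1)) *
           bergman_kernel (D_inv_dom n q r) (vector [0, w1, w2]) (vector [0, \<xi>1, \<xi>2]) =
         bergman_kernel (D_dom q r :: (complex^('n + 2)) set)
           (join_point 0 w1 w2) (join_point 0 \<xi>1 \<xi>2)"
proof -
  let ?D = "D_dom q r :: (complex^('n + 2)) set" and ?D' = "D_inv_dom n q r"
  note [simp] = assms(1)
  have D: "open ?D" and D': "open ?D'"
    using assms(2,3) by (auto intro: open_D_dom open_D_inv_dom)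
  have powr_less_1: "cmod z powr a < 1" if "cmod z < 1" "a > 0" for z a
    using powr_less_mono2[of a "cmod z" 1] that by simp
  have w: "(w1, w2) \<in> bidisc q r" and \<xi>: "(\<xi>1, \<xi>2) \<in> bidisc q r"
    using assms powr_less_1 by (auto simp: bidisc_def)
  then obtain k where k: "reproduces ?D' (centre_inv (\<xi>1, \<xi>2)) k"
    using exists_reproducing_function[OF D', of "centre_inv (\<xi>1, \<xi>2)"] by auto
  have "bergman_kernel ?D' (centre_inv (w1, w2)) (centre_inv (\<xi>1, \<xi>2)) = k (centre_inv (w1, w2))"
    using w \<xi> by (intro bergman_kernel_eqI[OF D' _ _ k]) simp_all
  moreover have "bergman_kernel ?D (centre_D (w1, w2)) (centre_D (\<xi>1, \<xi>2)) =
      of_real (1 / volume_ratio n) * k (centre_inv (base_D (centre_D (w1, w2) :: complex^('n + 2))))"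
    using w \<xi> reproduces_D_dom[OF assms(2,3) \<xi>, of k] k by (intro bergman_kernel_eqI[OF D]) simp_all
  ultimately show ?thesis
    by (simp add: centre_D_def centre_inv_def base_D_def volume_ratio_def)
qed

end
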